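(* Consider the closed-loop linear stochastic system without switching ($m=1$) described in the context, with state-control trajectory $\mathbf{w}$ and covariance matrix $\Sigma_{\mathbf w}$. Let $n_k$ be a positive integer, $\mathcal{Q}_j\in\mathbb{R}^{n_k\times n_w}$ and $\tilde\Sigma_j\in\mathbb{S}^{n_k}_{++}$. The policy with control parameters $\chi$ leads to a closed-loop system satisfying $$\forall\zeta\in\mathscr{D}^N:\quad \mathcal{Q}_j\,\Sigma_{\mathbf w}\,\mathcal{Q}_j^{\mathrm T}\preceq\tilde\Sigma_j$$ if and only if $$\mathcal{Q}_j\,\bm{\mathcal{B}}^{(s)}\,\Sigma_{\bm\epsilon}\,\bm{\mathcal{B}}^{(s)\mathrm T}\,\mathcal{Q}_j^{\mathrm T}\preceq\tilde\Sigma_j,$$ where $\bm{\mathcal{B}}^{(s)}=\bm{\mathcal{B}}^{(s)}[\chi]$ and $\Sigma_{\bm\epsilon}$ are as in the context. Moreover, the set of $\chi$ satisfying the latter matrix inequality is convex.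
   Context: $\mathbb{S}^n$ denotes real symmetric $n\times n$ matrices, $\mathbb{S}^n_+$ ($\mathbb{S}^n_{++}$) the positive semidefinite (definite) ones, and $A\preceq B$ means $B-A\in\mathbb{S}^n_+$. Fix positive integers $n_x,n_u,n_d,n_e,n_y,N$; let $n_w=n_xN+n_uN$, $n_\zeta=n_x+Nn_d$, $n_\epsilon=n_x+Nn_e$. System, for $t=0,\dots,N-1$: $$\mathbf x_0=z+\mathbf s_0,\quad \mathbf x_{t+1}=A_t\mathbf x_t+B_t\mathbf u_t+B_t^{(d)}d_t+B_t^{(s)}\mathbf e_t,\quad \mathbf y_t=C_t\mathbf x_t+D_t^{(d)}d_t+D_t^{(s)}\mathbf e_t,$$ with $\mathbf x_t\in\mathbb{R}^{n_x}$, $\mathbf u_t\in\mathbb{R}^{n_u}$, $d_t\in\mathbb{R}^{n_d}$, $\mathbf e_t\in\mathbb{R}^{n_e}$, $\mathbf y_t\in\mathbb{R}^{n_y}$ and given deterministic matrices of conformable sizes; $\mathbf s_0\sim\mathcal N(0,\Sigma_0)$ with $\Sigma_0\in\mathbb{S}^{n_x}_{++}$, $\mathbf e_t\sim\mathcal N(0,I)$, and $\mathbf s_0,\mathbf e_0,\dots,\mathbf e_{N-1}$ jointly independent. The deterministic uncertainty vector is $\zeta=(z,d_0,\dots,d_{N-1})\in\mathscr{D}^N=\{\zeta\in\mathbb{R}^{n_\zeta}:\langle Q_i\zeta,\zeta\rangle\le1,\ 1\le i\le s\}$, where $Q_i\in\mathbb{S}^{n_\zeta}_+$ and $\sum_iQ_i\succ0$.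 Purified-output-based affine policy: let $\hat{\mathbf x}_0=0$, $\hat{\mathbf x}_{t+1}=A_t\hat{\mathbf x}_t+B_t\mathbf u_t$, $\hat{\mathbf y}_t=C_t\hat{\mathbf x}_t$, and let $\mathbf v_t=\mathbf y_t-\hat{\mathbf y}_t$ be the purified outputs. The control is $\mathbf u_t=h_t+\sum_{i=0}^tH_i^t\mathbf v_i$, with parameters $h_t\in\mathbb{R}^{n_u}$, $H_i^t\in\mathbb{R}^{n_u\times n_y}$, $0\le i\le t\le N-1$; $\chi$ is the real vector listing all these parameters. The state-control trajectory is $\mathbf w=(\mathbf x_1,\dots,\mathbf x_N,\mathbf u_0,\dots,\mathbf u_{N-1})\in\mathbb{R}^{n_w}$ (stacked column), and $\Sigma_{\mathbf w}=\mathbb{E}[(\mathbf w-\mathbb{E}\mathbf w)(\mathbf w-\mathbb{E}\mathbf w)^{\mathrm T}]$ (expectation over $\mathbf s_0,\mathbf e_0,\dots,\mathbf e_{N-1}$, for fixed $\zeta$ and $\chi$). $\Sigma_{\bm\epsilon}=\begin{bmatrix}\Sigma_0&0\\0&I\end{bmatrix}\in\mathbb{S}^{n_\epsilon}_{++}$ is the covariance of $\bm\epsilon=(\mathbf s_0,\mathbf e_0,\dots,\mathbf e_{N-1})$. For $t\ge\tau$ let $\bm\Gamma[t,\tau]=A_{t-1}\cdots A_\tau$ ($\bm\Gamma[t,t]=I$). Block matrices (block indices $k,j\in\{0,\dots,N-1\}$; unspecified blocks are zero): $\underline{\mathbf A}$ has $k$-th block $\bm\Gamma[k+1,0]$; $\underline{\mathbf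 B}$, $\underline{\mathbf B}^{(s)}$ have $(k,j)$ block, for $k\ge j$, $\bm\Gamma[k+1,j+1]B_j$, $\bm\Gamma[k+1,j+1]B_j^{(s)}$ respectively; $\underline{\mathbf C}$ has $k$-th block $C_k\bm\Gamma[k,0]$; $\underline{\mathbf D}^{(s)}$ has $(k,j)$ block $D_j^{(s)}$ if $k=j$ and $C_k\bm\Gamma[k,j+1]B_j^{(s)}$ if $k>j$; $\underline{\mathbf H}$ has $(k,j)$ block $H_j^k$ for $k\ge j$. Then $$\bm{\mathcal{B}}^{(s)}=\begin{bmatrix}\underline{\mathbf B}\,\underline{\mathbf H}\,\underline{\mathbf C}+\underline{\mathbf A}&\underline{\mathbf B}\,\underline{\mathbf H}\,\underline{\mathbf D}^{(s)}+\underline{\mathbf B}^{(s)}\\ \underline{\mathbf H}\,\underline{\mathbf C}&\underline{\mathbf H}\,\underline{\mathbf D}^{(s)}\end{bmatrix}\in\mathbb{R}^{n_w\times n_\epsilon}.$$ *)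

theory Defs
  imports "HOL-Probability.Probability" "Jordan_Normal_Form.Matrix"
begin

hide_type (open) Finite_Cartesian_Product.vec
hide_const (open) Finite_Cartesian_Product.vec Finite_Cartesian_Product.mat
unbundle no vec_syntax and no inner_syntax


definition psd_mats :: "nat \<Rightarrow> real mat set" where
  "psd_mats n = {A \<in> carrier_mat n n. transpose_mat A = A \<and>
     (\<forall>x \<in> carrier_vec n. 0 \<le> (A *\<^sub>v x) \<bullet> x)}"

definition pd_mats :: "nat \<Rightarrow> real mat set" where
  "pd_mats n = {A \<in> carrier_mat n n. transpose_mat A = A \<and>
     (\<forall>x \<in> carrier_vec n. x \<noteq> 0\<^sub>v n \<longrightarrow> 0 < (A *\<^sub>v x) \<bullet> x)}"

definition loewner_le :: "nat \<Rightarrow> real mat \<Rightarrow> real mat \<Rightarrow> bool" where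
  "loewner_le n A B \<longleftrightarrow>
     A \<in> carrier_mat n n \<and> B \<in> carrier_mat n n \<and> B - A \<in> psd_mats n"

text \<open>The library's convexity predicate needs a type of class \<open>real_vector\<close>, which vectors of
  variable dimension do not form.\<close>

definition convex_vecs :: "real vec set \<Rightarrow> bool" where
  "convex_vecs S \<longleftrightarrow> (\<forall>x \<in> S. \<forall>y \<in> S. \<forall>a \<ge> 0. \<forall>b \<ge> 0.
     a + b = 1 \<longrightarrow> a \<cdot>\<^sub>v x + b \<cdot>\<^sub>v y \<in> S)"

definition stack_vec :: "nat \<Rightarrow> nat \<Rightarrow> (nat \<Rightarrow> real vec) \<Rightarrow> real vec" where
  "stack_vec m n f = vec (m * n) (\<lambda>i. f (i div n) $ (i mod n))"

text \<open>The matrix with \<open>p \<times> q\<close> blocks, each of size \<open>r \<times> c\<close>, the block \<open>(k, j)\<close> being \<open>F k j\<close>.\<close>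

definition block_mat :: "nat \<Rightarrow> nat \<Rightarrow> nat \<Rightarrow> nat \<Rightarrow> (nat \<Rightarrow> nat \<Rightarrow> real mat) \<Rightarrow> real mat" where
  "block_mat p q r c F =
     mat (p * r) (q * c) (\<lambda>(i, j). F (i div r) (j div c) $$ (i mod r, j mod c))"


text \<open>The Borel sigma-algebra on the vectors of dimension \<open>n\<close>.\<close>

definition vec_borel :: "nat \<Rightarrow> real vec measure" where
  "vec_borel n = vimage_algebra (carrier_vec n) (\<lambda>v. \<lambda>i\<in>{..<n}. v $ i)
     (\<Pi>\<^sub>M i\<in>{..<n}. borel)"

definition normal_law :: "real \<Rightarrow> real \<Rightarrow> real measure" where
  "normal_law m v = (if v = 0 then return borel m else density lborel (normal_density m (sqrt v)))"

text \<open>A random vector has law \<open>N(\<mu>, \<Sigma>)\<close> iff every linear functional \<open>\<langle>c, X\<rangle>\<close> of it has the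
  univariate law \<open>N(\<langle>c, \<mu>\<rangle>, \<langle>c, \<Sigma> c\<rangle>)\<close>, Dirac measures counting as normal laws of
  variance \<open>0\<close>.\<close>

definition gaussian_vec ::
  "'w measure \<Rightarrow> nat \<Rightarrow> ('w \<Rightarrow> real vec) \<Rightarrow> real vec \<Rightarrow> real mat \<Rightarrow> bool" where
  "gaussian_vec M n X \<mu> \<Sigma> \<longleftrightarrow> X \<in> measurable M (vec_borel n) \<and>
     (\<forall>c \<in> carrier_vec n.
        distr M borel (\<lambda>\<omega>. c \<bullet> X \<omega>) = normal_law (c \<bullet> \<mu>) (c \<bullet> (\<Sigma> *\<^sub>v c)))"

definition expect_vec :: "'w measure \<Rightarrow> nat \<Rightarrow> ('w \<Rightarrow> real vec) \<Rightarrow> real vec" where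
  "expect_vec M n X = vec n (\<lambda>i. \<integral>\<omega>. X \<omega> $ i \<partial>M)"

definition expect_mat :: "'w measure \<Rightarrow> nat \<Rightarrow> nat \<Rightarrow> ('w \<Rightarrow> real mat) \<Rightarrow> real mat" where
  "expect_mat M r c X = mat r c (\<lambda>(i, j). \<integral>\<omega>. X \<omega> $$ (i, j) \<partial>M)"

definition col_mat :: "real vec \<Rightarrow> real mat" where
  "col_mat v = mat_of_cols (dim_vec v) [v]"

definition cov_mat :: "'w measure \<Rightarrow> nat \<Rightarrow> ('w \<Rightarrow> real vec) \<Rightarrow> real mat" where
  "cov_mat M n X = expect_mat M n n (\<lambda>\<omega>.
     col_mat (X \<omega> - expect_vec M n X) * transpose_mat (col_mat (X \<omega> - expect_vec M n X)))"


record lin_sys =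
  nx :: nat
  nu :: nat
  nd :: nat
  ne :: nat
  ny :: nat
  horizon :: nat
  sysA :: "nat \<Rightarrow> real mat"
  sysB :: "nat \<Rightarrow> real mat"
  sysBd :: "nat \<Rightarrow> real mat"
  sysBs :: "nat \<Rightarrow> real mat"
  sysC :: "nat \<Rightarrow> real mat"
  sysDd :: "nat \<Rightarrow> real mat"
  sysDs :: "nat \<Rightarrow> real mat"

definition wf_sys :: "lin_sys \<Rightarrow> bool" where
  "wf_sys S \<longleftrightarrow>
     0 < nx S \<and> 0 < nu S \<and> 0 < nd S \<and> 0 < ne S \<and> 0 < ny S \<and> 0 < horizon S \<and>
     (\<forall>t < horizon S.
        sysA S t \<in> carrier_mat (nx S) (nx S) \<and>
        sysB S t \<in> carrier_mat (nx S) (nu S) \<and>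
        sysBd S t \<in> carrier_mat (nx S) (nd S) \<and>
        sysBs S t \<in> carrier_mat (nx S) (ne S) \<and>
        sysC S t \<in> carrier_mat (ny S) (nx S) \<and>
        sysDd S t \<in> carrier_mat (ny S) (nd S) \<and>
        sysDs S t \<in> carrier_mat (ny S) (ne S))"

definition n_w :: "lin_sys \<Rightarrow> nat" where
  "n_w S = nx S * horizon S + nu S * horizon S"

definition n_zeta :: "lin_sys \<Rightarrow> nat" where
  "n_zeta S = nx S + horizon S * nd S"

definition zeta_z :: "lin_sys \<Rightarrow> real vec \<Rightarrow> real vec" where
  "zeta_z S \<zeta> = vec_first \<zeta> (nx S)"

definition zeta_d :: "lin_sys \<Rightarrow> real vec \<Rightarrow> nat \<Rightarrow> real vec" where
  "zeta_d S \<zeta> t = vec (nd S) (\<lambda>i. \<zeta> $ (nx S + t * nd S + i))"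

definition uncertainty_set :: "lin_sys \<Rightarrow> nat \<Rightarrow> (nat \<Rightarrow> real mat) \<Rightarrow> real vec set" where
  "uncertainty_set S s Q =
     {\<zeta> \<in> carrier_vec (n_zeta S). \<forall>i \<in> {1..s}. (Q i *\<^sub>v \<zeta>) \<bullet> \<zeta> \<le> 1}"


text \<open>The vector \<open>\<chi>\<close> of policy parameters lists, for \<open>t = 0, \<dots>, N - 1\<close> in turn, first the
  entries of \<open>h\<^sub>t\<close> and then, row by row, those of the matrices \<open>H\<^sub>i\<^sup>t\<close> for \<open>i = 0, \<dots>, t\<close>.\<close>

definition chi_offset :: "lin_sys \<Rightarrow> nat \<Rightarrow> nat" where
  "chi_offset S t = (\<Sum>r<t. nu S + (r + 1) * (nu S * ny S))"

definition n_chi :: "lin_sys \<Rightarrow> nat" where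
  "n_chi S = chi_offset S (horizon S)"

definition pol_h :: "lin_sys \<Rightarrow> real vec \<Rightarrow> nat \<Rightarrow> real vec" where
  "pol_h S \<chi> t = vec (nu S) (\<lambda>k. \<chi> $ (chi_offset S t + k))"

text \<open>\<open>pol_H S \<chi> t i\<close> is the matrix \<open>H\<^sub>i\<^sup>t\<close>.\<close>

definition pol_H :: "lin_sys \<Rightarrow> real vec \<Rightarrow> nat \<Rightarrow> nat \<Rightarrow> real mat" where
  "pol_H S \<chi> t i = mat (nu S) (ny S)
     (\<lambda>(k, l). \<chi> $ (chi_offset S t + nu S + i * (nu S * ny S) + k * ny S + l))"


lemma foldSetD_cong_subset:
  assumes "(B, y) \<in> foldSetD D f e" and "\<And>x. x \<in> B \<Longrightarrow> f x = g x"
  shows "(B, y) \<in> foldSetD D g e"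
  using assms by induct (auto intro: foldSetD.intros)

lemma finsum_vec_fundef_cong [fundef_cong]:
  assumes "ty = ty'" "n = n'" "A = B" and "\<And>x. x \<in> B \<Longrightarrow> f x = g x"
  shows "finsum_vec ty n f A = finsum_vec ty' n' g B"
proof -
  let ?G = "monoid_vec ty n"
  have "(B, y) \<in> foldSetD (carrier ?G) (\<lambda>x. mult ?G (f x)) \<one>\<^bsub>?G\<^esub> \<longleftrightarrow>
        (B, y) \<in> foldSetD (carrier ?G) (\<lambda>x. mult ?G (g x)) \<one>\<^bsub>?G\<^esub>" for y
    using assms(4) by (auto elim!: foldSetD_cong_subset)
  then show ?thesis
    using assms(1-3) by (simp add: finsum_vec_def finprod_def foldD_def comp_def)
qed

text \<open>The closed loop, for fixed \<open>\<chi>\<close>, \<open>\<zeta>\<close> and realizations \<open>s0\<close>, \<open>e\<close> of the noise: states,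
  model states, outputs, purified outputs and controls.\<close>

function
  cl_x :: "lin_sys \<Rightarrow> real vec \<Rightarrow> real vec \<Rightarrow> real vec \<Rightarrow> (nat \<Rightarrow> real vec) \<Rightarrow> nat \<Rightarrow> real vec" and
  cl_xhat :: "lin_sys \<Rightarrow> real vec \<Rightarrow> real vec \<Rightarrow> real vec \<Rightarrow> (nat \<Rightarrow> real vec) \<Rightarrow> nat \<Rightarrow> real vec" and
  cl_y :: "lin_sys \<Rightarrow> real vec \<Rightarrow> real vec \<Rightarrow> real vec \<Rightarrow> (nat \<Rightarrow> real vec) \<Rightarrow> nat \<Rightarrow> real vec" and
  cl_v :: "lin_sys \<Rightarrow> real vec \<Rightarrow> real vec \<Rightarrow> real vec \<Rightarrow> (nat \<Rightarrow> real vec) \<Rightarrow> nat \<Rightarrow> real vec" and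
  cl_u :: "lin_sys \<Rightarrow> real vec \<Rightarrow> real vec \<Rightarrow> real vec \<Rightarrow> (nat \<Rightarrow> real vec) \<Rightarrow> nat \<Rightarrow> real vec"
where
  "cl_x S \<chi> \<zeta> s0 e 0 = zeta_z S \<zeta> + s0"
| "cl_x S \<chi> \<zeta> s0 e (Suc t) =
     sysA S t *\<^sub>v cl_x S \<chi> \<zeta> s0 e t + sysB S t *\<^sub>v cl_u S \<chi> \<zeta> s0 e t
     + sysBd S t *\<^sub>v zeta_d S \<zeta> t + sysBs S t *\<^sub>v e t"
| "cl_xhat S \<chi> \<zeta> s0 e 0 = 0\<^sub>v (nx S)"
| "cl_xhat S \<chi> \<zeta> s0 e (Suc t) =
     sysA S t *\<^sub>v cl_xhat S \<chi> \<zeta> s0 e t + sysB S t *\<^sub>v cl_u S \<chi> \<zeta> s0 e t"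
| "cl_y S \<chi> \<zeta> s0 e t =
     sysC S t *\<^sub>v cl_x S \<chi> \<zeta> s0 e t + sysDd S t *\<^sub>v zeta_d S \<zeta> t + sysDs S t *\<^sub>v e t"
| "cl_v S \<chi> \<zeta> s0 e t = cl_y S \<chi> \<zeta> s0 e t - sysC S t *\<^sub>v cl_xhat S \<chi> \<zeta> s0 e t"
| "cl_u S \<chi> \<zeta> s0 e t = pol_h S \<chi> t +
     finsum_vec TYPE(real) (nu S) (\<lambda>i. pol_H S \<chi> t i *\<^sub>v cl_v S \<chi> \<zeta> s0 e i) {0..t}"
  by pat_completeness auto
termination
proof (relation "Wellfounded.measure (\<lambda>p. case p of
    Inl (Inl (S, \<chi>, \<zeta>, s0, e, t)) \<Rightarrow> 4 * t
  | Inl (Inr (S, \<chi>, \<zeta>, s0, e, t)) \<Rightarrow> 4 * t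
  | Inr (Inl (S, \<chi>, \<zeta>, s0, e, t)) \<Rightarrow> 4 * t + 1
  | Inr (Inr (Inl (S, \<chi>, \<zeta>, s0, e, t))) \<Rightarrow> 4 * t + 2
  | Inr (Inr (Inr (S, \<chi>, \<zeta>, s0, e, t))) \<Rightarrow> 4 * t + 3)")
qed auto

definition traj ::
  "lin_sys \<Rightarrow> real vec \<Rightarrow> real vec \<Rightarrow> real vec \<Rightarrow> (nat \<Rightarrow> real vec) \<Rightarrow> real vec" where
  "traj S \<chi> \<zeta> s0 e =
     stack_vec (horizon S) (nx S) (\<lambda>k. cl_x S \<chi> \<zeta> s0 e (Suc k))
     @\<^sub>v stack_vec (horizon S) (nu S) (\<lambda>k. cl_u S \<chi> \<zeta> s0 e k)"

definition Sigma_w ::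
  "'w measure \<Rightarrow> lin_sys \<Rightarrow> ('w \<Rightarrow> real vec) \<Rightarrow> (nat \<Rightarrow> 'w \<Rightarrow> real vec)
     \<Rightarrow> real vec \<Rightarrow> real vec \<Rightarrow> real mat" where
  "Sigma_w M S s0 e \<chi> \<zeta> =
     cov_mat M (n_w S) (\<lambda>\<omega>. traj S \<chi> \<zeta> (s0 \<omega>) (\<lambda>t. e t \<omega>))"

text \<open>The noise vectors \<open>s\<^sub>0, e\<^sub>0, e\<^sub>1, \<dots>\<close> as one sequence, and their dimensions.\<close>

definition noise :: "('w \<Rightarrow> real vec) \<Rightarrow> (nat \<Rightarrow> 'w \<Rightarrow> real vec) \<Rightarrow> nat \<Rightarrow> 'w \<Rightarrow> real vec" where
  "noise s0 e k = (case k of 0 \<Rightarrow> s0 | Suc t \<Rightarrow> e t)"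

definition noise_dim :: "lin_sys \<Rightarrow> nat \<Rightarrow> nat" where
  "noise_dim S k = (case k of 0 \<Rightarrow> nx S | Suc t \<Rightarrow> ne S)"

definition noise_model ::
  "'w measure \<Rightarrow> lin_sys \<Rightarrow> real mat \<Rightarrow> ('w \<Rightarrow> real vec) \<Rightarrow> (nat \<Rightarrow> 'w \<Rightarrow> real vec) \<Rightarrow> bool" where
  "noise_model M S \<Sigma>0 s0 e \<longleftrightarrow>
     gaussian_vec M (nx S) s0 (0\<^sub>v (nx S)) \<Sigma>0 \<and>
     (\<forall>t < horizon S. gaussian_vec M (ne S) (e t) (0\<^sub>v (ne S)) (1\<^sub>m (ne S))) \<and>
     prob_space.indep_vars M (\<lambda>k. vec_borel (noise_dim S k)) (noise s0 e) {0..horizon S}"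

definition Sigma_eps :: "lin_sys \<Rightarrow> real mat \<Rightarrow> real mat" where
  "Sigma_eps S \<Sigma>0 = four_block_mat
     \<Sigma>0 (0\<^sub>m (nx S) (horizon S * ne S))
     (0\<^sub>m (horizon S * ne S) (nx S)) (1\<^sub>m (horizon S * ne S))"


text \<open>\<open>Gam S t \<tau>\<close> is \<open>A\<^sub>t\<^sub>-\<^sub>1 \<cdots> A\<^sub>\<tau>\<close>; only the values for \<open>\<tau> \<le> t\<close> are used.\<close>

primrec Gam :: "lin_sys \<Rightarrow> nat \<Rightarrow> nat \<Rightarrow> real mat" where
  "Gam S 0 \<tau> = 1\<^sub>m (nx S)"
| "Gam S (Suc t) \<tau> = (if \<tau> \<le> t then sysA S t * Gam S t \<tau> else 1\<^sub>m (nx S))"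

definition bigA :: "lin_sys \<Rightarrow> real mat" where
  "bigA S = block_mat (horizon S) 1 (nx S) (nx S) (\<lambda>k j. Gam S (k + 1) 0)"

definition bigB :: "lin_sys \<Rightarrow> real mat" where
  "bigB S = block_mat (horizon S) (horizon S) (nx S) (nu S)
     (\<lambda>k j. if j \<le> k then Gam S (k + 1) (j + 1) * sysB S j else 0\<^sub>m (nx S) (nu S))"

definition bigBs :: "lin_sys \<Rightarrow> real mat" where
  "bigBs S = block_mat (horizon S) (horizon S) (nx S) (ne S)
     (\<lambda>k j. if j \<le> k then Gam S (k + 1) (j + 1) * sysBs S j else 0\<^sub>m (nx S) (ne S))"

definition bigC :: "lin_sys \<Rightarrow> real mat" where
  "bigC S = block_mat (horizon S) 1 (ny S) (nx S) (\<lambda>k j. sysC S k * Gam S k 0)"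

definition bigDs :: "lin_sys \<Rightarrow> real mat" where
  "bigDs S = block_mat (horizon S) (horizon S) (ny S) (ne S)
     (\<lambda>k j. if k = j then sysDs S j
            else if j < k then sysC S k * Gam S k (j + 1) * sysBs S j
            else 0\<^sub>m (ny S) (ne S))"

definition bigH :: "lin_sys \<Rightarrow> real vec \<Rightarrow> real mat" where
  "bigH S \<chi> = block_mat (horizon S) (horizon S) (nu S) (ny S)
     (\<lambda>k j. if j \<le> k then pol_H S \<chi> k j else 0\<^sub>m (nu S) (ny S))"

definition calBs :: "lin_sys \<Rightarrow> real vec \<Rightarrow> real mat" where
  "calBs S \<chi> = four_block_mat
     (bigB S * bigH S \<chi> * bigC S + bigA S) (bigB S * bigH S \<chi> * bigDs S + bigBs S)
     (bigH S \<chi> * bigC S) (bigH S \<chi> * bigDs S)"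

end

theory Submission
  imports Defs
begin

text \<open>
  The purified outputs do not depend on the controls: \<open>x - xhat\<close> obeys a recursion driven by \<open>\<zeta>\<close>
  and the noise only. Hence for fixed \<open>\<zeta>\<close> the trajectory is \<open>w = w\<^sub>0 + B \<epsilon>\<close>, where \<open>w\<^sub>0\<close> is
  the noise-free trajectory and \<open>B\<close> is the matrix \<open>calBs S \<chi>\<close>, obtained by unrolling the recursions.
  Since \<open>\<epsilon>\<close> is centered with covariance \<open>\<Sigma>\<^sub>\<epsilon>\<close>, the covariance of \<open>w\<close> is \<open>B \<Sigma>\<^sub>\<epsilon> B\<^sup>T\<close> for every \<open>\<zeta>\<close>;
  as the uncertainty set contains \<open>0\<close>, the robust constraint is the single matrix inequality.
  For convexity, \<open>B\<close> is affine in \<open>\<chi>\<close> and, for each fixed vector \<open>x\<close>, the number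
  \<open>\<langle>\<Sigma>\<^sub>\<epsilon> B\<^sup>T Q\<^sup>T x, B\<^sup>T Q\<^sup>T x\<rangle>\<close> is a convex quadratic function of \<open>B\<close>.
\<close>

section \<open>Stacked vectors and block matrices\<close>

text \<open>A flat index \<open>j\<close> encodes block \<open>j div c\<close> and position
  \<open>j mod c\<close>; the range is grouped into segments of length \<open>c\<close>, each
  shifted back to 0. Block multiplication rests on this regrouping.\<close>

lemma sum_div_mod:
  fixes g :: "nat \<Rightarrow> nat \<Rightarrow> 'a :: comm_monoid_add"
  shows "(\<Sum>j<q * c. g (j div c) (j mod c)) = (\<Sum>a<q. \<Sum>b<c. g a b)"
proof -
  have "(\<Sum>j\<in>{a * c..<a * c + c}. g (j div c) (j mod c)) = (\<Sum>b<c. g a b)" for a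
  proof -
    have "(\<Sum>j\<in>{0 + a * c..<c + a * c}. g (j div c) (j mod c))
        = (\<Sum>b\<in>{0..<c}. g ((b + a * c) div c) ((b + a * c) mod c))"
      by (rule sum.shift_bounds_nat_ivl)
    also have "\<dots> = (\<Sum>b\<in>{0..<c}. g a b)"
      by (rule sum.cong) auto
    finally show ?thesis by (simp add: add.commute lessThan_atLeast0)
  qed
  then show ?thesis
    by (subst sum.nat_group[symmetric]) simp
qed

text \<open>Defined entrywise, so that the result has dimension \<open>n\<close> whatever the
  summands are and the empty sum is the zero vector.\<close>

definition vec_sum :: "nat \<Rightarrow> (nat \<Rightarrow> real vec) \<Rightarrow> nat \<Rightarrow> real vec" where
  "vec_sum n f m = vec n (\<lambda>i. \<Sum>j<m. f j $ i)"

lemma vec_sum_carrier [simp]: "vec_sum n f m \<in> carrier_vec n"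
  and dim_vec_sum [simp]: "dim_vec (vec_sum n f m) = n"
  and index_vec_sum [simp]: "i < n \<Longrightarrow> vec_sum n f m $ i = (\<Sum>j<m. f j $ i)"
  by (auto simp: vec_sum_def)

lemma vec_sum_0: "vec_sum n f 0 = 0\<^sub>v n"
  by (rule eq_vecI) auto

lemma vec_sum_Suc:
  "f m \<in> carrier_vec n \<Longrightarrow> vec_sum n f (Suc m) = vec_sum n f m + f m"
  by (rule eq_vecI) auto

lemma vec_sum_cong:
  "(\<And>j. j < m \<Longrightarrow> f j = g j) \<Longrightarrow> vec_sum n f m = vec_sum n g m"
  by (rule eq_vecI) auto

lemma vec_sum_add:
  assumes "\<And>j. j < m \<Longrightarrow> g j \<in> carrier_vec n"
  shows "vec_sum n (\<lambda>j. f j + g j) m = vec_sum n f m + vec_sum n g m"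
proof (rule eq_vecI)
  fix i assume "i < dim_vec (vec_sum n f m + vec_sum n g m)"
  then have i: "i < n" by simp
  have "(f j + g j) $ i = f j $ i + g j $ i" if "j < m" for j
    using assms[OF that] i by simp
  with i show "vec_sum n (\<lambda>j. f j + g j) m $ i = (vec_sum n f m + vec_sum n g m) $ i"
    by (simp add: sum.distrib)
qed simp

text \<open>Serves lower block triangular matrices: the zero blocks to the right of the diagonal
  leave only the first \<open>Suc k\<close> summands of row \<open>k\<close>.\<close>

lemma vec_sum_restrict:
  assumes "k < m"
  shows "vec_sum n (\<lambda>j. if j \<le> k then f j else 0\<^sub>v n) m = vec_sum n f (Suc k)"
proof (rule eq_vecI)
  fix i assume "i < dim_vec (vec_sum n f (Suc k))"
  then have i: "i < n" by simp
  have "(\<Sum>j<m. (if j \<le> k then f j else 0\<^sub>v n) $ i) = (\<Sum>j<Suc k. f j $ i)"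
    using assms i by (intro sum.mono_neutral_cong_right) auto
  with i show "vec_sum n (\<lambda>j. if j \<le> k then f j else 0\<^sub>v n) m $ i = vec_sum n f (Suc k) $ i"
    by simp
qed simp

lemma mult_mat_vec_sum:
  assumes A: "A \<in> carrier_mat r n" and f: "\<And>j. j < m \<Longrightarrow> f j \<in> carrier_vec n"
  shows "A *\<^sub>v vec_sum n f m = vec_sum r (\<lambda>j. A *\<^sub>v f j) m"
  using f
proof (induction m)
  case 0
  then show ?case using A by (intro eq_vecI) (auto simp: vec_sum_0)
next
  case (Suc m)
  then have "f m \<in> carrier_vec n" by simp
  with Suc A show ?case
    by (simp add: vec_sum_Suc mult_add_distrib_mat_vec[of _ r n])
qed

text \<open>Brings the sum in the control law into the form used everywhere else.\<close>

lemma finsum_vec_eq_vec_sum: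
  assumes "\<And>i. i \<le> t \<Longrightarrow> f i \<in> carrier_vec n"
  shows "finsum_vec TYPE(real) n f {0..t} = vec_sum n f (Suc t)"
proof (rule eq_vecI)
  have f: "f \<in> {0..t} \<rightarrow> carrier_vec n" using assms by auto
  have c: "finsum_vec TYPE(real) n f {0..t} \<in> carrier_vec n"
    by (rule finsum_vec_closed[OF f])
  then show "dim_vec (finsum_vec TYPE(real) n f {0..t}) = dim_vec (vec_sum n f (Suc t))"
    by auto
  fix i assume "i < dim_vec (vec_sum n f (Suc t))"
  then show "finsum_vec TYPE(real) n f {0..t} $ i = vec_sum n f (Suc t) $ i"
    using index_finsum_vec[OF _ _ f, of i]
    by (simp add: lessThan_Suc_atMost atLeast0AtMost del: sum.lessThan_Suc)
qed

lemma stack_vec_carrier [simp]: "stack_vec m n f \<in> carrier_vec (m * n)"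
  by (simp add: stack_vec_def)

lemma block_mat_carrier [simp]: "block_mat p q r c F \<in> carrier_mat (p * r) (q * c)"
  by (simp add: block_mat_def)

lemma stack_vec_cong:
  assumes "\<And>k. k < m \<Longrightarrow> f k = g k"
  shows "stack_vec m n f = stack_vec m n g"
  using assms by (auto simp: stack_vec_def less_mult_imp_div_less intro!: eq_vecI)

lemma mod_less_of_less_mult: "i < p * r \<Longrightarrow> i mod r < (r :: nat)"
  by (cases r) auto

lemma stack_vec_add:
  assumes "\<And>k. k < m \<Longrightarrow> g k \<in> carrier_vec n"
  shows "stack_vec m n (\<lambda>k. f k + g k) = stack_vec m n f + stack_vec m n g"
proof (rule eq_vecI)
  fix i assume "i < dim_vec (stack_vec m n f + stack_vec m n g)"
  then have i: "i < m * n" by (simp add: stack_vec_def)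
  with assms have "g (i div n) \<in> carrier_vec n" by (simp add: less_mult_imp_div_less)
  then show "stack_vec m n (\<lambda>k. f k + g k) $ i = (stack_vec m n f + stack_vec m n g) $ i"
    using i mod_less_of_less_mult[OF i] by (simp add: stack_vec_def)
qed (simp add: stack_vec_def)

text \<open>An entry of the product is one sum over flat column indices, which
  \<open>sum_div_mod\<close> regroups block by block.\<close>

lemma block_mat_mult_stack_vec:
  assumes F: "\<And>k j. k < p \<Longrightarrow> j < q \<Longrightarrow> F k j \<in> carrier_mat r c"
    and f: "\<And>j. j < q \<Longrightarrow> f j \<in> carrier_vec c"
  shows "block_mat p q r c F *\<^sub>v stack_vec q c f
       = stack_vec p r (\<lambda>k. vec_sum r (\<lambda>j. F k j *\<^sub>v f j) q)"
proof (rule eq_vecI)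
  fix i assume "i < dim_vec (stack_vec p r (\<lambda>k. vec_sum r (\<lambda>j. F k j *\<^sub>v f j) q))"
  then have i: "i < p * r" by (simp add: stack_vec_def)
  define k l where "k = i div r" and "l = i mod r"
  have k: "k < p" and l: "l < r"
    using i mod_less_of_less_mult[OF i] by (auto simp: k_def l_def less_mult_imp_div_less)
  have "(block_mat p q r c F *\<^sub>v stack_vec q c f) $ i
      = (\<Sum>j<q * c. F k (j div c) $$ (l, j mod c) * f (j div c) $ (j mod c))"
    using i by (simp add: block_mat_def stack_vec_def scalar_prod_def k_def l_def lessThan_atLeast0)
  also have "\<dots> = (\<Sum>a<q. \<Sum>b<c. F k a $$ (l, b) * f a $ b)"
    by (rule sum_div_mod)
  also have "\<dots> = (\<Sum>a<q. (F k a *\<^sub>v f a) $ l)"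
  proof (rule sum.cong)
    fix a assume "a \<in> {..<q}"
    then have "F k a \<in> carrier_mat r c" "f a \<in> carrier_vec c" using F[OF k] f by auto
    then show "(\<Sum>b<c. F k a $$ (l, b) * f a $ b) = (F k a *\<^sub>v f a) $ l"
      using l by (auto simp: scalar_prod_def lessThan_atLeast0)
  qed simp
  finally show "(block_mat p q r c F *\<^sub>v stack_vec q c f) $ i
      = stack_vec p r (\<lambda>k. vec_sum r (\<lambda>j. F k j *\<^sub>v f j) q) $ i"
    using i l by (simp add: stack_vec_def k_def l_def)
qed (simp add: block_mat_def stack_vec_def)

text \<open>A vector is a stack of one block, so this is the case of a single block column, the
  shape of \<open>bigA\<close> and \<open>bigC\<close>.\<close>

lemma block_mat_mult_vec:
  assumes F: "\<And>k. k < p \<Longrightarrow> F k \<in> carrier_mat r c" and v: "v \<in> carrier_vec c"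
  shows "block_mat p 1 r c (\<lambda>k j. F k) *\<^sub>v v = stack_vec p r (\<lambda>k. F k *\<^sub>v v)"
proof -
  have "v = stack_vec 1 c (\<lambda>j. v)"
    using v by (intro eq_vecI) (auto simp: stack_vec_def)
  then have "block_mat p 1 r c (\<lambda>k j. F k) *\<^sub>v v
      = block_mat p 1 r c (\<lambda>k j. F k) *\<^sub>v stack_vec 1 c (\<lambda>j. v)"
    by simp
  also have "\<dots> = stack_vec p r (\<lambda>k. vec_sum r (\<lambda>j. F k *\<^sub>v v) 1)"
    using F v by (intro block_mat_mult_stack_vec) auto
  also have "\<dots> = stack_vec p r (\<lambda>k. F k *\<^sub>v v)"
  proof (intro stack_vec_cong)
    fix k assume "k < p"
    then have "F k *\<^sub>v v \<in> carrier_vec r" by (intro mult_mat_vec_carrier[OF F v])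
    then show "vec_sum r (\<lambda>j. F k *\<^sub>v v) 1 = F k *\<^sub>v v"
      by (intro eq_vecI) (auto simp del: index_mult_mat_vec dim_mult_mat_vec)
  qed
  finally show ?thesis .
qed

text \<open>Causality of \<open>bigB\<close>, \<open>bigBs\<close>, \<open>bigDs\<close> and
  \<open>bigH\<close>: the zero blocks above the diagonal cut the sum in row \<open>k\<close> off
  after \<open>j = k\<close>.\<close>

lemma block_lower_mult_stack_vec:
  assumes F: "\<And>k j. j \<le> k \<Longrightarrow> k < p \<Longrightarrow> F k j \<in> carrier_mat r c"
    and f: "\<And>j. j < p \<Longrightarrow> f j \<in> carrier_vec c"
  shows "block_mat p p r c (\<lambda>k j. if j \<le> k then F k j else 0\<^sub>m r c) *\<^sub>v stack_vec p c f
       = stack_vec p r (\<lambda>k. vec_sum r (\<lambda>j. F k j *\<^sub>v f j) (Suc k))"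
proof -
  have "block_mat p p r c (\<lambda>k j. if j \<le> k then F k j else 0\<^sub>m r c) *\<^sub>v stack_vec p c f
      = stack_vec p r (\<lambda>k. vec_sum r (\<lambda>j. (if j \<le> k then F k j else 0\<^sub>m r c) *\<^sub>v f j) p)"
    using F f by (intro block_mat_mult_stack_vec) auto
  also have "\<dots> = stack_vec p r (\<lambda>k. vec_sum r (\<lambda>j. if j \<le> k then F k j *\<^sub>v f j else 0\<^sub>v r) p)"
    using f by (intro stack_vec_cong vec_sum_cong) auto
  also have "\<dots> = stack_vec p r (\<lambda>k. vec_sum r (\<lambda>j. F k j *\<^sub>v f j) (Suc k))"
    by (intro stack_vec_cong vec_sum_restrict)
  finally show ?thesis .
qed

subsection \<open>Unrolling the closed loop\<close>

lemma wf_sysD: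
  assumes "wf_sys S" "t < horizon S"
  shows "sysA S t \<in> carrier_mat (nx S) (nx S)" "sysB S t \<in> carrier_mat (nx S) (nu S)"
    "sysBd S t \<in> carrier_mat (nx S) (nd S)" "sysBs S t \<in> carrier_mat (nx S) (ne S)"
    "sysC S t \<in> carrier_mat (ny S) (nx S)" "sysDd S t \<in> carrier_mat (ny S) (nd S)"
    "sysDs S t \<in> carrier_mat (ny S) (ne S)"
  using assms by (auto simp: wf_sys_def)

lemma Gam_carrier:
  "wf_sys S \<Longrightarrow> t \<le> horizon S \<Longrightarrow> Gam S t \<tau> \<in> carrier_mat (nx S) (nx S)"
  by (induction t) (auto intro!: mult_carrier_mat wf_sysD)

lemma Gam_self: "Gam S t t = 1\<^sub>m (nx S)"
  by (cases t) auto

text \<open>Discrete variation of constants: one more step multiplies every transition matrix by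
  \<open>sysA S t\<close> from the left and appends the new input. The sequence \<open>X\<close> is
  arbitrary so that the formula serves both \<open>resp_d\<close> and \<open>resp_x\<close>.\<close>

lemma variation_of_constants:
  assumes wf: "wf_sys S" and p: "p \<in> carrier_vec (nx S)"
    and g: "\<And>t. t < horizon S \<Longrightarrow> g t \<in> carrier_vec (nx S)"
    and X0: "X 0 = p"
    and XS: "\<And>t. t < horizon S \<Longrightarrow> X (Suc t) = sysA S t *\<^sub>v X t + g t"
  shows "t \<le> horizon S \<Longrightarrow> X t = Gam S t 0 *\<^sub>v p + vec_sum (nx S) (\<lambda>j. Gam S t (Suc j) *\<^sub>v g j) t"
proof (induction t)
  case 0
  then show ?case using p by (simp add: X0 vec_sum_0)
next
  case (Suc t)
  let ?n = "nx S"
  have t: "t < horizon S" "t \<le> horizon S" using Suc.prems by auto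
  note A = wf_sysD(1)[OF wf t(1)] and G = Gam_carrier[OF wf t(2)]
  have gj: "g j \<in> carrier_vec ?n" if "j \<le> t" for j using g that t by auto
  have "X (Suc t) = sysA S t *\<^sub>v (Gam S t 0 *\<^sub>v p + vec_sum ?n (\<lambda>j. Gam S t (Suc j) *\<^sub>v g j) t) + g t"
    using Suc t by (simp add: XS)
  also have "\<dots> = (sysA S t * Gam S t 0) *\<^sub>v p
      + vec_sum ?n (\<lambda>j. sysA S t *\<^sub>v (Gam S t (Suc j) *\<^sub>v g j)) t + g t"
  proof -
    have "sysA S t *\<^sub>v vec_sum ?n (\<lambda>j. Gam S t (Suc j) *\<^sub>v g j) t
        = vec_sum ?n (\<lambda>j. sysA S t *\<^sub>v (Gam S t (Suc j) *\<^sub>v g j)) t"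
      using G gj by (intro mult_mat_vec_sum[OF A] mult_mat_vec_carrier[OF G]) auto
    moreover have "sysA S t *\<^sub>v (Gam S t 0 *\<^sub>v p + vec_sum ?n (\<lambda>j. Gam S t (Suc j) *\<^sub>v g j) t)
        = sysA S t *\<^sub>v (Gam S t 0 *\<^sub>v p) + sysA S t *\<^sub>v vec_sum ?n (\<lambda>j. Gam S t (Suc j) *\<^sub>v g j) t"
      using mult_mat_vec_carrier[OF G p] by (intro mult_add_distrib_mat_vec[OF A]) auto
    ultimately show ?thesis
      by (simp add: assoc_mult_mat_vec[OF A G p])
  qed
  \<comment> \<open>For \<open>j < t\<close> the transition matrix unfolds by its recursive branch,
    since \<open>Suc j \<le> t\<close>.\<close>
  also have "vec_sum ?n (\<lambda>j. sysA S t *\<^sub>v (Gam S t (Suc j) *\<^sub>v g j)) t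
      = vec_sum ?n (\<lambda>j. Gam S (Suc t) (Suc j) *\<^sub>v g j) t"
    using A G gj by (intro vec_sum_cong) (simp add: assoc_mult_mat_vec[of _ ?n ?n _ ?n])
  \<comment> \<open>The newest input \<open>g t\<close> gets the identity
    \<open>Gam S (Suc t) (Suc t)\<close> in front, to become the last summand.\<close>
  also have "(sysA S t * Gam S t 0) *\<^sub>v p + \<dots> + g t = Gam S (Suc t) 0 *\<^sub>v p
      + (\<dots> + Gam S (Suc t) (Suc t) *\<^sub>v g t)"
    using mult_mat_vec_carrier[OF mult_carrier_mat[OF A G] p] gj[of t] unfolding Gam_self
    by (subst assoc_add_vec[of _ ?n]) auto
  also have "vec_sum ?n (\<lambda>j. Gam S (Suc t) (Suc j) *\<^sub>v g j) t + Gam S (Suc t) (Suc t) *\<^sub>v g t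
     = vec_sum ?n (\<lambda>j. Gam S (Suc t) (Suc j) *\<^sub>v g j) (Suc t)"
    using gj[of t] by (subst vec_sum_Suc) (simp_all add: Gam_self del: Gam.simps)
  finally show ?case .
qed

declare cl_x.simps(2) [simp del] cl_xhat.simps(2) [simp del] cl_y.simps [simp del]
  cl_v.simps [simp del] cl_u.simps [simp del]

lemma pol_carrier [simp]:
  "pol_h S \<chi> t \<in> carrier_vec (nu S)" "pol_H S \<chi> t i \<in> carrier_mat (nu S) (ny S)"
  by (auto simp: pol_h_def pol_H_def)

lemma zeta_z_carrier [simp]: "zeta_z S \<zeta> \<in> carrier_vec (nx S)"
  by (simp add: zeta_z_def)

text \<open>One realization of the noise \<epsilon> = (s_0, e_0, ..., e_{N-1}), with
  \<open>p\<close> in the place of s_0.\<close>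

definition eps_vec :: "lin_sys \<Rightarrow> real vec \<Rightarrow> (nat \<Rightarrow> real vec) \<Rightarrow> real vec" where
  "eps_vec S p E = p @\<^sub>v stack_vec (horizon S) (ne S) E"

text \<open>The responses of \<open>x - xhat\<close>, \<open>v\<close>, \<open>u\<close> and \<open>x\<close> to the noise alone, that is, the closed loop
  with \<open>\<zeta> = 0\<close> and \<open>h = 0\<close>. The recursion for \<open>x - xhat\<close> does not involve the control,
  which is why \<open>u\<close> is an affine function of the noise.\<close>

primrec resp_d :: "lin_sys \<Rightarrow> real vec \<Rightarrow> (nat \<Rightarrow> real vec) \<Rightarrow> nat \<Rightarrow> real vec" where
  "resp_d S p E 0 = p"
| "resp_d S p E (Suc t) = sysA S t *\<^sub>v resp_d S p E t + sysBs S t *\<^sub>v E t"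

definition resp_v :: "lin_sys \<Rightarrow> real vec \<Rightarrow> (nat \<Rightarrow> real vec) \<Rightarrow> nat \<Rightarrow> real vec" where
  "resp_v S p E t = sysC S t *\<^sub>v resp_d S p E t + sysDs S t *\<^sub>v E t"

definition resp_u :: "lin_sys \<Rightarrow> real vec \<Rightarrow> real vec \<Rightarrow> (nat \<Rightarrow> real vec) \<Rightarrow> nat \<Rightarrow> real vec" where
  "resp_u S \<chi> p E t = vec_sum (nu S) (\<lambda>i. pol_H S \<chi> t i *\<^sub>v resp_v S p E i) (Suc t)"

primrec resp_x :: "lin_sys \<Rightarrow> real vec \<Rightarrow> real vec \<Rightarrow> (nat \<Rightarrow> real vec) \<Rightarrow> nat \<Rightarrow> real vec" where
  "resp_x S \<chi> p E 0 = p"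
| "resp_x S \<chi> p E (Suc t) =
     sysA S t *\<^sub>v resp_x S \<chi> p E t + (sysB S t *\<^sub>v resp_u S \<chi> p E t + sysBs S t *\<^sub>v E t)"

text \<open>The hypothesis concerns differences, but in the closed loop a matrix multiplies the
  state and the model state separately; hence the distributed form of the conclusion.\<close>

lemma mult_mat_vec_response:
  fixes A :: "real mat"
  assumes A: "A \<in> carrier_mat r n" and eq: "x - h = (x' - h') + d"
    and c: "x \<in> carrier_vec n" "h \<in> carrier_vec n" "x' \<in> carrier_vec n" "h' \<in> carrier_vec n"
      "d \<in> carrier_vec n"
  shows "A *\<^sub>v x - A *\<^sub>v h = (A *\<^sub>v x' - A *\<^sub>v h') + A *\<^sub>v d"
proof -
  have "A *\<^sub>v x - A *\<^sub>v h = A *\<^sub>v ((x' - h') + d)"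
    unfolding eq[symmetric] using A c by (intro mult_minus_distrib_mat_vec[symmetric])
  also have "\<dots> = A *\<^sub>v (x' - h') + A *\<^sub>v d"
    using c by (intro mult_add_distrib_mat_vec[OF A]) auto
  also have "A *\<^sub>v (x' - h') = A *\<^sub>v x' - A *\<^sub>v h'"
    using A c by (intro mult_minus_distrib_mat_vec)
  finally show ?thesis .
qed

lemma big_carrier [simp]:
  "bigA S \<in> carrier_mat (horizon S * nx S) (nx S)"
  "bigB S \<in> carrier_mat (horizon S * nx S) (horizon S * nu S)"
  "bigBs S \<in> carrier_mat (horizon S * nx S) (horizon S * ne S)"
  "bigC S \<in> carrier_mat (horizon S * ny S) (nx S)"
  "bigDs S \<in> carrier_mat (horizon S * ny S) (horizon S * ne S)"
  "bigH S \<chi> \<in> carrier_mat (horizon S * nu S) (horizon S * ny S)"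
  using block_mat_carrier[of "horizon S" 1 "nx S" "nx S"] block_mat_carrier[of "horizon S" 1 "ny S" "nx S"]
  by (auto simp: bigA_def bigB_def bigBs_def bigC_def bigDs_def bigH_def simp del: Gam.simps)

context
  fixes S :: lin_sys
  assumes wf: "wf_sys S"
begin

text \<open>A case distinction suffices: a sum of vectors takes its dimension from the right
  summand, so the state at \<open>Suc n\<close> has as many entries as \<open>sysBs S n\<close> has
  rows.\<close>

lemma cl_x_carrier:
  "p \<in> carrier_vec (nx S) \<Longrightarrow> t \<le> horizon S \<Longrightarrow> cl_x S \<chi> \<zeta> p E t \<in> carrier_vec (nx S)"
proof (cases t)
  case (Suc n)
  assume "t \<le> horizon S"
  with Suc have "dim_row (sysBs S n) = nx S" using wf_sysD(4)[OF wf, of n] by auto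
  with Suc show ?thesis by (intro carrier_vecI) (simp add: cl_x.simps(2))
qed simp

lemma cl_xhat_carrier:
  "t \<le> horizon S \<Longrightarrow> cl_xhat S \<chi> \<zeta> p E t \<in> carrier_vec (nx S)"
proof (cases t)
  case (Suc n)
  assume "t \<le> horizon S"
  with Suc have "dim_row (sysB S n) = nx S" using wf_sysD(2)[OF wf, of n] by auto
  with Suc show ?thesis by (intro carrier_vecI) (simp add: cl_xhat.simps(2))
qed simp

lemma cl_v_carrier: "t < horizon S \<Longrightarrow> cl_v S \<chi> \<zeta> p E t \<in> carrier_vec (ny S)"
  using wf_sysD(5)[OF wf, of t] by (intro carrier_vecI) (auto simp: cl_v.simps)

lemma cl_u_eq:
  "t < horizon S \<Longrightarrow> cl_u S \<chi> \<zeta> p E t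
     = pol_h S \<chi> t + vec_sum (nu S) (\<lambda>i. pol_H S \<chi> t i *\<^sub>v cl_v S \<chi> \<zeta> p E i) (Suc t)"
  by (subst cl_u.simps, subst finsum_vec_eq_vec_sum)
    (auto intro!: mult_mat_vec_carrier[OF pol_carrier(2)] cl_v_carrier)

lemma cl_u_carrier: "t < horizon S \<Longrightarrow> cl_u S \<chi> \<zeta> p E t \<in> carrier_vec (nu S)"
  by (simp add: cl_u_eq)

lemma resp_d_carrier:
  "p \<in> carrier_vec (nx S) \<Longrightarrow> t \<le> horizon S \<Longrightarrow> resp_d S p E t \<in> carrier_vec (nx S)"
proof (cases t)
  case (Suc n)
  assume "t \<le> horizon S"
  with Suc have "dim_row (sysBs S n) = nx S" using wf_sysD(4)[OF wf, of n] by auto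
  with Suc show ?thesis by (intro carrier_vecI) simp
qed simp

lemma resp_v_carrier: "t < horizon S \<Longrightarrow> resp_v S p E t \<in> carrier_vec (ny S)"
  using wf_sysD(7)[OF wf, of t] by (intro carrier_vecI) (auto simp: resp_v_def)

lemma resp_u_carrier: "resp_u S \<chi> p E t \<in> carrier_vec (nu S)"
  by (simp add: resp_u_def)

lemma resp_x_carrier:
  "p \<in> carrier_vec (nx S) \<Longrightarrow> t \<le> horizon S \<Longrightarrow> resp_x S \<chi> p E t \<in> carrier_vec (nx S)"
proof (cases t)
  case (Suc n)
  assume "t \<le> horizon S"
  with Suc have "dim_row (sysBs S n) = nx S" using wf_sysD(4)[OF wf, of n] by auto
  with Suc show ?thesis by (intro carrier_vecI) simp
qed simp

context
  fixes p :: "real vec" and E :: "nat \<Rightarrow> real vec"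
  assumes p: "p \<in> carrier_vec (nx S)"
    and E: "\<And>t. t < horizon S \<Longrightarrow> E t \<in> carrier_vec (ne S)"
begin

text \<open>Induction on \<open>t\<close>. The control enters \<open>cl_x\<close> and
  \<open>cl_xhat\<close> through the same term, and the disturbance enters the noisy and the
  noise-free run through the same term; so only \<open>sysA\<close> and \<open>sysBs\<close> act on
  the difference of the two errors.\<close>

lemma cl_error_response:
  "t \<le> horizon S \<Longrightarrow> cl_x S \<chi> \<zeta> p E t - cl_xhat S \<chi> \<zeta> p E t
     = (cl_x S \<chi> \<zeta> (0\<^sub>v (nx S)) (\<lambda>_. 0\<^sub>v (ne S)) t - cl_xhat S \<chi> \<zeta> (0\<^sub>v (nx S)) (\<lambda>_. 0\<^sub>v (ne S)) t) + resp_d S p E t"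
proof (induction t)
  case 0
  then show ?case using p zeta_z_carrier[of S \<zeta>] by (intro eq_vecI) auto
next
  case (Suc t)
  then have t: "t < horizon S" "t \<le> horizon S" by auto
  note M = wf_sysD[OF wf t(1)]
  let ?x = "cl_x S \<chi> \<zeta> p E t" and ?h = "cl_xhat S \<chi> \<zeta> p E t"
  let ?xz = "cl_x S \<chi> \<zeta> (0\<^sub>v (nx S)) (\<lambda>_. 0\<^sub>v (ne S)) t" and ?hz = "cl_xhat S \<chi> \<zeta> (0\<^sub>v (nx S)) (\<lambda>_. 0\<^sub>v (ne S)) t"
  let ?u = "cl_u S \<chi> \<zeta> p E t" and ?uz = "cl_u S \<chi> \<zeta> (0\<^sub>v (nx S)) (\<lambda>_. 0\<^sub>v (ne S)) t"
  have c: "?x \<in> carrier_vec (nx S)" "?xz \<in> carrier_vec (nx S)"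
    "?h \<in> carrier_vec (nx S)" "?hz \<in> carrier_vec (nx S)" "resp_d S p E t \<in> carrier_vec (nx S)"
    "?u \<in> carrier_vec (nu S)" "?uz \<in> carrier_vec (nu S)"
    using p t by (auto intro!: cl_x_carrier cl_xhat_carrier resp_d_carrier cl_u_carrier)
  have 1: "sysA S t *\<^sub>v ?x - sysA S t *\<^sub>v ?h
      = (sysA S t *\<^sub>v ?xz - sysA S t *\<^sub>v ?hz) + sysA S t *\<^sub>v resp_d S p E t"
    by (rule mult_mat_vec_response[OF M(1) Suc.IH[OF t(2)] c(1,3,2,4,5)])
  have 2: "sysBs S t *\<^sub>v 0\<^sub>v (ne S) = 0\<^sub>v (nx S)"
    using M by (intro eq_vecI) auto
  have d: "dim_row (sysA S t) = nx S" "dim_row (sysB S t) = nx S" "dim_row (sysBs S t) = nx S"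
    "dim_row (sysBd S t) = nx S"
    using M by auto
  show ?case
  proof (rule eq_vecI)
    fix i assume "i < dim_vec (cl_x S \<chi> \<zeta> (0\<^sub>v (nx S)) (\<lambda>_. 0\<^sub>v (ne S)) (Suc t) - cl_xhat S \<chi> \<zeta> (0\<^sub>v (nx S)) (\<lambda>_. 0\<^sub>v (ne S)) (Suc t) + resp_d S p E (Suc t))"
    then have i: "i < nx S" using d by (simp add: cl_xhat.simps(2))
    \<comment> \<open>The control terms of the noisy run cancel within the left side and those of
      the noise-free run within the right side, although the two controls differ.\<close>
    show "(cl_x S \<chi> \<zeta> p E (Suc t) - cl_xhat S \<chi> \<zeta> p E (Suc t)) $ i =
      (cl_x S \<chi> \<zeta> (0\<^sub>v (nx S)) (\<lambda>_. 0\<^sub>v (ne S)) (Suc t) - cl_xhat S \<chi> \<zeta> (0\<^sub>v (nx S)) (\<lambda>_. 0\<^sub>v (ne S)) (Suc t) + resp_d S p E (Suc t)) $ i"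
      using i d arg_cong[OF 1, of "\<lambda>v. v $ i"]
      by (simp add: cl_x.simps(2) cl_xhat.simps(2) 2 del: index_mult_mat_vec)
  qed (use d in \<open>simp add: cl_x.simps(2) cl_xhat.simps(2)\<close>)
qed

text \<open>The purified output sees the state only through the error \<open>cl_x - cl_xhat\<close>,
  and its disturbance term is common to both runs.\<close>

lemma cl_v_response:
  assumes t: "t < horizon S"
  shows "cl_v S \<chi> \<zeta> p E t = cl_v S \<chi> \<zeta> (0\<^sub>v (nx S)) (\<lambda>_. 0\<^sub>v (ne S)) t + resp_v S p E t"
proof -
  note M = wf_sysD[OF wf t]
  let ?x = "cl_x S \<chi> \<zeta> p E t" and ?h = "cl_xhat S \<chi> \<zeta> p E t"
  let ?xz = "cl_x S \<chi> \<zeta> (0\<^sub>v (nx S)) (\<lambda>_. 0\<^sub>v (ne S)) t" and ?hz = "cl_xhat S \<chi> \<zeta> (0\<^sub>v (nx S)) (\<lambda>_. 0\<^sub>v (ne S)) t"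
  have c: "?x \<in> carrier_vec (nx S)" "?xz \<in> carrier_vec (nx S)"
    "?h \<in> carrier_vec (nx S)" "?hz \<in> carrier_vec (nx S)" "resp_d S p E t \<in> carrier_vec (nx S)"
    using p t by (auto intro!: cl_x_carrier cl_xhat_carrier resp_d_carrier)
  have 1: "sysC S t *\<^sub>v ?x - sysC S t *\<^sub>v ?h
      = (sysC S t *\<^sub>v ?xz - sysC S t *\<^sub>v ?hz) + sysC S t *\<^sub>v resp_d S p E t"
    by (rule mult_mat_vec_response[OF M(5) cl_error_response[OF less_imp_le[OF t]] c(1,3,2,4,5)])
  have 2: "sysDs S t *\<^sub>v 0\<^sub>v (ne S) = 0\<^sub>v (ny S)"
    using M by (intro eq_vecI) auto
  have d: "dim_row (sysC S t) = ny S" "dim_row (sysDs S t) = ny S" "dim_row (sysDd S t) = ny S"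
    using M by auto
  show ?thesis
  proof (rule eq_vecI)
    fix i assume "i < dim_vec (cl_v S \<chi> \<zeta> (0\<^sub>v (nx S)) (\<lambda>_. 0\<^sub>v (ne S)) t + resp_v S p E t)"
    then have i: "i < ny S" using d by (simp add: resp_v_def)
    show "cl_v S \<chi> \<zeta> p E t $ i = (cl_v S \<chi> \<zeta> (0\<^sub>v (nx S)) (\<lambda>_. 0\<^sub>v (ne S)) t + resp_v S p E t) $ i"
      using i d arg_cong[OF 1, of "\<lambda>v. v $ i"]
      by (simp add: cl_v.simps cl_y.simps resp_v_def 2 del: index_mult_mat_vec)
  qed (use d in \<open>simp add: cl_v.simps resp_v_def\<close>)
qed

text \<open>The control is affine in the purified outputs: the offset \<open>pol_h\<close> belongs
  to the noise-free control, and the gains \<open>pol_H\<close> act on the responses.\<close>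

lemma cl_u_response:
  assumes t: "t < horizon S"
  shows "cl_u S \<chi> \<zeta> p E t = cl_u S \<chi> \<zeta> (0\<^sub>v (nx S)) (\<lambda>_. 0\<^sub>v (ne S)) t + resp_u S \<chi> p E t"
proof -
  let ?H = "pol_H S \<chi> t"
  have "vec_sum (nu S) (\<lambda>i. ?H i *\<^sub>v cl_v S \<chi> \<zeta> p E i) (Suc t)
      = vec_sum (nu S) (\<lambda>i. ?H i *\<^sub>v cl_v S \<chi> \<zeta> (0\<^sub>v (nx S)) (\<lambda>_. 0\<^sub>v (ne S)) i + ?H i *\<^sub>v resp_v S p E i) (Suc t)"
  proof (rule vec_sum_cong)
    fix i assume "i < Suc t"
    then have i: "i < horizon S" using t by simp
    show "?H i *\<^sub>v cl_v S \<chi> \<zeta> p E i = ?H i *\<^sub>v cl_v S \<chi> \<zeta> (0\<^sub>v (nx S)) (\<lambda>_. 0\<^sub>v (ne S)) i + ?H i *\<^sub>v resp_v S p E i"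
      unfolding cl_v_response[OF i]
      by (rule mult_add_distrib_mat_vec[OF pol_carrier(2) cl_v_carrier[OF i] resp_v_carrier[OF i]])
  qed
  also have "\<dots> = vec_sum (nu S) (\<lambda>i. ?H i *\<^sub>v cl_v S \<chi> \<zeta> (0\<^sub>v (nx S)) (\<lambda>_. 0\<^sub>v (ne S)) i) (Suc t) + resp_u S \<chi> p E t"
    unfolding resp_u_def using t
    by (intro vec_sum_add mult_mat_vec_carrier[OF pol_carrier(2)] resp_v_carrier) auto
  finally show ?thesis
    using t by (simp add: cl_u_eq assoc_add_vec[OF pol_carrier(1) vec_sum_carrier resp_u_carrier])
qed

text \<open>Once the control is split, the state recursion is linear in what remains; the
  contributions of \<open>\<zeta>\<close> are those of the noise-free run.\<close>

lemma cl_x_response: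
  "t \<le> horizon S \<Longrightarrow> cl_x S \<chi> \<zeta> p E t = cl_x S \<chi> \<zeta> (0\<^sub>v (nx S)) (\<lambda>_. 0\<^sub>v (ne S)) t + resp_x S \<chi> p E t"
proof (induction t)
  case 0
  then show ?case using p zeta_z_carrier[of S \<zeta>] by (intro eq_vecI) auto
next
  case (Suc t)
  then have t: "t < horizon S" "t \<le> horizon S" by auto
  note M = wf_sysD[OF wf t(1)]
  have 1: "sysA S t *\<^sub>v cl_x S \<chi> \<zeta> p E t
      = sysA S t *\<^sub>v cl_x S \<chi> \<zeta> (0\<^sub>v (nx S)) (\<lambda>_. 0\<^sub>v (ne S)) t + sysA S t *\<^sub>v resp_x S \<chi> p E t"
    unfolding Suc.IH[OF t(2)] using p t
    by (intro mult_add_distrib_mat_vec[OF M(1)] cl_x_carrier resp_x_carrier) auto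
  have 2: "sysB S t *\<^sub>v cl_u S \<chi> \<zeta> p E t
      = sysB S t *\<^sub>v cl_u S \<chi> \<zeta> (0\<^sub>v (nx S)) (\<lambda>_. 0\<^sub>v (ne S)) t + sysB S t *\<^sub>v resp_u S \<chi> p E t"
    unfolding cl_u_response[OF t(1)] using p t
    by (intro mult_add_distrib_mat_vec[OF M(2)] cl_u_carrier resp_u_carrier) auto
  have 3: "sysBs S t *\<^sub>v 0\<^sub>v (ne S) = 0\<^sub>v (nx S)"
    using M by (intro eq_vecI) auto
  have d: "dim_row (sysA S t) = nx S" "dim_row (sysB S t) = nx S" "dim_row (sysBs S t) = nx S"
    "dim_row (sysBd S t) = nx S"
    using M by auto
  show ?case
    by (rule eq_vecI) (use d in \<open>simp_all add: cl_x.simps(2) 1 2 3 del: index_mult_mat_vec\<close>)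
qed

section \<open>The stacked responses in terms of the block matrices\<close>

text \<open>Row \<open>k\<close> is the variation of constants formula for \<open>resp_d\<close>,
  multiplied by \<open>sysC S k\<close>, plus the feedthrough of the current noise.\<close>

lemma stack_resp_v:
  "stack_vec (horizon S) (ny S) (resp_v S p E)
     = bigC S *\<^sub>v p + bigDs S *\<^sub>v stack_vec (horizon S) (ne S) E"
proof -
  let ?N = "horizon S"
  let ?F = "\<lambda>k j. if k = j then sysDs S j else sysC S k * Gam S k (j + 1) * sysBs S j"
  have F: "?F k j \<in> carrier_mat (ny S) (ne S)" if "j \<le> k" "k < ?N" for k j
    using that wf_sysD[OF wf, of k] wf_sysD[OF wf, of j] Gam_carrier[OF wf, of k "j+1"]
    by (auto intro!: mult_carrier_mat)
  have Bs: "sysBs S j *\<^sub>v E j \<in> carrier_vec (nx S)" if "j < ?N" for j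
    using wf_sysD(4)[OF wf that] E[OF that] by simp
  have CG: "sysC S k * Gam S k 0 \<in> carrier_mat (ny S) (nx S)" if "k < ?N" for k
    using that wf_sysD[OF wf, of k] Gam_carrier[OF wf, of k 0] by (auto intro!: mult_carrier_mat)
  have "bigDs S *\<^sub>v stack_vec ?N (ne S) E
      = stack_vec ?N (ny S) (\<lambda>k. vec_sum (ny S) (\<lambda>j. ?F k j *\<^sub>v E j) (Suc k))"
  proof -
    \<comment> \<open>\<open>?F\<close> merges the diagonal and the subdiagonal case, so that
      \<open>bigDs\<close> takes the lower triangular form.\<close>
    have "bigDs S = block_mat ?N ?N (ny S) (ne S) (\<lambda>k j. if j \<le> k then ?F k j else 0\<^sub>m (ny S) (ne S))"
      unfolding bigDs_def by (intro arg_cong[where f = "block_mat _ _ _ _"] ext) auto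
    then show ?thesis by (simp only: block_lower_mult_stack_vec[OF F E])
  qed
  moreover have "bigC S *\<^sub>v p = stack_vec ?N (ny S) (\<lambda>k. (sysC S k * Gam S k 0) *\<^sub>v p)"
    unfolding bigC_def by (rule block_mat_mult_vec[OF CG p])
  moreover have "stack_vec ?N (ny S) (resp_v S p E) = stack_vec ?N (ny S)
      (\<lambda>k. (sysC S k * Gam S k 0) *\<^sub>v p + vec_sum (ny S) (\<lambda>j. ?F k j *\<^sub>v E j) (Suc k))"
  proof (rule stack_vec_cong)
    fix k assume k: "k < ?N"
    note M = wf_sysD[OF wf k] and G = Gam_carrier[OF wf less_imp_le[OF k]]
    have "resp_d S p E k = Gam S k 0 *\<^sub>v p
        + vec_sum (nx S) (\<lambda>j. Gam S k (Suc j) *\<^sub>v (sysBs S j *\<^sub>v E j)) k"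
      using k by (intro variation_of_constants[OF wf p Bs]) auto
    then have "sysC S k *\<^sub>v resp_d S p E k = sysC S k *\<^sub>v (Gam S k 0 *\<^sub>v p)
        + sysC S k *\<^sub>v vec_sum (nx S) (\<lambda>j. Gam S k (Suc j) *\<^sub>v (sysBs S j *\<^sub>v E j)) k"
      using mult_add_distrib_mat_vec[OF M(5) mult_mat_vec_carrier[OF G p] vec_sum_carrier] by simp
    also have "sysC S k *\<^sub>v vec_sum (nx S) (\<lambda>j. Gam S k (Suc j) *\<^sub>v (sysBs S j *\<^sub>v E j)) k
        = vec_sum (ny S) (\<lambda>j. sysC S k *\<^sub>v (Gam S k (Suc j) *\<^sub>v (sysBs S j *\<^sub>v E j))) k"
      using k by (intro mult_mat_vec_sum[OF M(5)] mult_mat_vec_carrier[OF G] Bs) auto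
    also have "\<dots> = vec_sum (ny S) (\<lambda>j. ?F k j *\<^sub>v E j) k"
    proof (rule vec_sum_cong)
      fix j assume j: "j < k"
      then have jN: "j < ?N" using k by simp
      show "sysC S k *\<^sub>v (Gam S k (Suc j) *\<^sub>v (sysBs S j *\<^sub>v E j)) = ?F k j *\<^sub>v E j"
        using j assoc_mult_mat_vec[OF mult_carrier_mat[OF M(5) G] wf_sysD(4)[OF wf jN] E[OF jN]]
          assoc_mult_mat_vec[OF M(5) G Bs[OF jN]]
        by simp
    qed
    finally have "resp_v S p E k = sysC S k *\<^sub>v (Gam S k 0 *\<^sub>v p)
        + vec_sum (ny S) (\<lambda>j. ?F k j *\<^sub>v E j) k + sysDs S k *\<^sub>v E k"
      by (simp add: resp_v_def)
    \<comment> \<open>The state at time \<open>k\<close> has seen the inputs \<open>j < k\<close>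
      only; the feedthrough \<open>sysDs S k\<close> supplies the summand
      \<open>j = k\<close>.\<close>
    also have "\<dots> = (sysC S k * Gam S k 0) *\<^sub>v p
        + (vec_sum (ny S) (\<lambda>j. ?F k j *\<^sub>v E j) k + ?F k k *\<^sub>v E k)"
      using M(5,7) E[OF k] p
      by (subst assoc_add_vec[of _ "ny S"])
        (auto simp: assoc_mult_mat_vec[OF M(5) G p] intro!: mult_mat_vec_carrier[OF M(5)] mult_mat_vec_carrier[OF G])
    also have "vec_sum (ny S) (\<lambda>j. ?F k j *\<^sub>v E j) k + ?F k k *\<^sub>v E k
        = vec_sum (ny S) (\<lambda>j. ?F k j *\<^sub>v E j) (Suc k)"
      using mult_mat_vec_carrier[OF F[OF order.refl k] E[OF k]] by (subst vec_sum_Suc) auto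
    finally show "resp_v S p E k = (sysC S k * Gam S k 0) *\<^sub>v p
        + vec_sum (ny S) (\<lambda>j. ?F k j *\<^sub>v E j) (Suc k)" .
  qed
  ultimately show ?thesis
    by (simp add: stack_vec_add)
qed

lemma stack_resp_u:
  "stack_vec (horizon S) (nu S) (resp_u S \<chi> p E)
     = bigH S \<chi> *\<^sub>v stack_vec (horizon S) (ny S) (resp_v S p E)"
  unfolding bigH_def
  by (subst block_lower_mult_stack_vec) (auto simp: resp_u_def[abs_def] resp_v_carrier)

text \<open>Variation of constants with control plus noise as forcing term, the sum then being split
  in two. Block \<open>k\<close> is the state at time \<open>Suc k\<close>, hence the transition
  matrices \<open>Gam S (k + 1) (j + 1)\<close>.\<close>

lemma stack_resp_x:
  "stack_vec (horizon S) (nx S) (\<lambda>k. resp_x S \<chi> p E (Suc k))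
     = bigA S *\<^sub>v p + (bigB S *\<^sub>v stack_vec (horizon S) (nu S) (resp_u S \<chi> p E)
         + bigBs S *\<^sub>v stack_vec (horizon S) (ne S) E)"
proof -
  let ?N = "horizon S" and ?n = "nx S"
  let ?G = "\<lambda>k j. Gam S (k + 1) (j + 1)"
  have G: "?G k j \<in> carrier_mat ?n ?n" if "k < ?N" for k j
    using that by (intro Gam_carrier[OF wf]) auto
  have FB: "?G k j * sysB S j \<in> carrier_mat ?n (nu S)" if "j \<le> k" "k < ?N" for k j
    using that wf_sysD(2)[OF wf, of j] G[of k j] by (auto intro!: mult_carrier_mat)
  have FBs: "?G k j * sysBs S j \<in> carrier_mat ?n (ne S)" if "j \<le> k" "k < ?N" for k j
    using that wf_sysD(4)[OF wf, of j] G[of k j] by (auto intro!: mult_carrier_mat)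
  have Bu: "sysB S j *\<^sub>v resp_u S \<chi> p E j \<in> carrier_vec ?n" if "j < ?N" for j
    using wf_sysD(2)[OF wf that] resp_u_carrier by simp
  have Bs: "sysBs S j *\<^sub>v E j \<in> carrier_vec ?n" if "j < ?N" for j
    using wf_sysD(4)[OF wf that] E[OF that] by simp
  have "resp_x S \<chi> p E (Suc k) = Gam S (k + 1) 0 *\<^sub>v p
      + (vec_sum ?n (\<lambda>j. (?G k j * sysB S j) *\<^sub>v resp_u S \<chi> p E j) (Suc k)
         + vec_sum ?n (\<lambda>j. (?G k j * sysBs S j) *\<^sub>v E j) (Suc k))" if k: "k < ?N" for k
  proof -
    have "resp_x S \<chi> p E (Suc k) = Gam S (Suc k) 0 *\<^sub>v p
        + vec_sum ?n (\<lambda>j. Gam S (Suc k) (Suc j) *\<^sub>v (sysB S j *\<^sub>v resp_u S \<chi> p E j + sysBs S j *\<^sub>v E j)) (Suc k)"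
      using k Bu Bs by (intro variation_of_constants[OF wf p]) auto
    also have "vec_sum ?n (\<lambda>j. Gam S (Suc k) (Suc j) *\<^sub>v (sysB S j *\<^sub>v resp_u S \<chi> p E j + sysBs S j *\<^sub>v E j)) (Suc k)
        = vec_sum ?n (\<lambda>j. (?G k j * sysB S j) *\<^sub>v resp_u S \<chi> p E j + (?G k j * sysBs S j) *\<^sub>v E j) (Suc k)"
    proof (rule vec_sum_cong)
      fix j assume "j < Suc k"
      then have j: "j < ?N" using k by simp
      have "?G k j *\<^sub>v (sysB S j *\<^sub>v resp_u S \<chi> p E j + sysBs S j *\<^sub>v E j)
          = (?G k j * sysB S j) *\<^sub>v resp_u S \<chi> p E j + (?G k j * sysBs S j) *\<^sub>v E j"
        using mult_add_distrib_mat_vec[OF G[OF k] Bu[OF j] Bs[OF j]]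
          assoc_mult_mat_vec[OF G[OF k] wf_sysD(2)[OF wf j] resp_u_carrier]
          assoc_mult_mat_vec[OF G[OF k] wf_sysD(4)[OF wf j] E[OF j]]
        by (simp del: Gam.simps)
      then show "Gam S (Suc k) (Suc j) *\<^sub>v (sysB S j *\<^sub>v resp_u S \<chi> p E j + sysBs S j *\<^sub>v E j)
          = (?G k j * sysB S j) *\<^sub>v resp_u S \<chi> p E j + (?G k j * sysBs S j) *\<^sub>v E j"
        by simp
    qed
    also have "\<dots> = vec_sum ?n (\<lambda>j. (?G k j * sysB S j) *\<^sub>v resp_u S \<chi> p E j) (Suc k)
         + vec_sum ?n (\<lambda>j. (?G k j * sysBs S j) *\<^sub>v E j) (Suc k)"
      using k by (intro vec_sum_add mult_mat_vec_carrier[OF FBs] E) auto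
    finally show ?thesis by simp
  qed
  then have "stack_vec ?N ?n (\<lambda>k. resp_x S \<chi> p E (Suc k)) = stack_vec ?N ?n (\<lambda>k. Gam S (k + 1) 0 *\<^sub>v p
      + (vec_sum ?n (\<lambda>j. (?G k j * sysB S j) *\<^sub>v resp_u S \<chi> p E j) (Suc k)
         + vec_sum ?n (\<lambda>j. (?G k j * sysBs S j) *\<^sub>v E j) (Suc k)))"
    by (rule stack_vec_cong)
  also have "\<dots> = stack_vec ?N ?n (\<lambda>k. Gam S (k + 1) 0 *\<^sub>v p)
      + (stack_vec ?N ?n (\<lambda>k. vec_sum ?n (\<lambda>j. (?G k j * sysB S j) *\<^sub>v resp_u S \<chi> p E j) (Suc k))
         + stack_vec ?N ?n (\<lambda>k. vec_sum ?n (\<lambda>j. (?G k j * sysBs S j) *\<^sub>v E j) (Suc k)))"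
    by (simp add: stack_vec_add del: Gam.simps)
  also have "stack_vec ?N ?n (\<lambda>k. Gam S (k + 1) 0 *\<^sub>v p) = bigA S *\<^sub>v p"
    unfolding bigA_def
    by (intro block_mat_mult_vec[symmetric] Gam_carrier[OF wf] p) auto
  also have "stack_vec ?N ?n (\<lambda>k. vec_sum ?n (\<lambda>j. (?G k j * sysB S j) *\<^sub>v resp_u S \<chi> p E j) (Suc k))
      = bigB S *\<^sub>v stack_vec ?N (nu S) (resp_u S \<chi> p E)"
    unfolding bigB_def by (intro block_lower_mult_stack_vec[symmetric] FB resp_u_carrier)
  also have "stack_vec ?N ?n (\<lambda>k. vec_sum ?n (\<lambda>j. (?G k j * sysBs S j) *\<^sub>v E j) (Suc k))
      = bigBs S *\<^sub>v stack_vec ?N (ne S) E"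
    unfolding bigBs_def by (intro block_lower_mult_stack_vec[symmetric] FBs E)
  finally show ?thesis .
qed

text \<open>The stacked purified outputs are inserted into the stacked control and that into the
  stacked state, which yields the four blocks of \<open>calBs\<close>. All dependence on
  \<open>\<zeta>\<close> stays in the noise-free trajectory.\<close>

lemma traj_response:
  "traj S \<chi> \<zeta> p E = traj S \<chi> \<zeta> (0\<^sub>v (nx S)) (\<lambda>_. 0\<^sub>v (ne S)) + calBs S \<chi> *\<^sub>v eps_vec S p E"
proof -
  let ?N = "horizon S"
  let ?E = "stack_vec ?N (ne S) E" and ?v = "stack_vec ?N (ny S) (resp_v S p E)"
  have v: "bigC S *\<^sub>v p + bigDs S *\<^sub>v ?E = ?v" by (simp add: stack_resp_v)
  have c: "bigC S *\<^sub>v p \<in> carrier_vec (?N * ny S)" "bigDs S *\<^sub>v ?E \<in> carrier_vec (?N * ny S)"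
    using p by (auto intro!: mult_mat_vec_carrier[OF big_carrier(4)] mult_mat_vec_carrier[OF big_carrier(5)])
  have HCD: "bigH S \<chi> *\<^sub>v (bigC S *\<^sub>v p) + bigH S \<chi> *\<^sub>v (bigDs S *\<^sub>v ?E)
      = stack_vec ?N (nu S) (resp_u S \<chi> p E)"
    using c by (simp add: mult_add_distrib_mat_vec[OF big_carrier(6), symmetric] v stack_resp_u)
  have u: "(bigH S \<chi> * bigC S) *\<^sub>v p + (bigH S \<chi> * bigDs S) *\<^sub>v ?E
      = stack_vec ?N (nu S) (resp_u S \<chi> p E)"
    using p HCD by (simp add: assoc_mult_mat_vec[OF big_carrier(6) big_carrier(4)]
      assoc_mult_mat_vec[OF big_carrier(6) big_carrier(5)])
  have hc: "bigH S \<chi> *\<^sub>v (bigC S *\<^sub>v p) \<in> carrier_vec (?N * nu S)"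
    "bigH S \<chi> *\<^sub>v (bigDs S *\<^sub>v ?E) \<in> carrier_vec (?N * nu S)"
    using c by (auto intro!: mult_mat_vec_carrier[OF big_carrier(6)])
  \<comment> \<open>Upper block row: the two terms beginning with
    \<open>bigB S * bigH S \<chi>\<close> add up to \<open>bigB S\<close> applied to the stacked
    control.\<close>
  have x: "(bigB S * bigH S \<chi> * bigC S + bigA S) *\<^sub>v p + (bigB S * bigH S \<chi> * bigDs S + bigBs S) *\<^sub>v ?E
      = stack_vec ?N (nx S) (\<lambda>k. resp_x S \<chi> p E (Suc k))"
  proof -
    note BH = mult_carrier_mat[OF big_carrier(2) big_carrier(6)]
    have "(bigB S * bigH S \<chi> * bigC S + bigA S) *\<^sub>v p
        = bigB S *\<^sub>v (bigH S \<chi> *\<^sub>v (bigC S *\<^sub>v p)) + bigA S *\<^sub>v p"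
      using add_mult_distrib_mat_vec[OF mult_carrier_mat[OF BH big_carrier(4)] big_carrier(1) p]
        assoc_mult_mat_vec[OF BH big_carrier(4) p]
        assoc_mult_mat_vec[OF big_carrier(2) big_carrier(6) c(1)] by simp
    moreover have "(bigB S * bigH S \<chi> * bigDs S + bigBs S) *\<^sub>v ?E
        = bigB S *\<^sub>v (bigH S \<chi> *\<^sub>v (bigDs S *\<^sub>v ?E)) + bigBs S *\<^sub>v ?E"
      using add_mult_distrib_mat_vec[OF mult_carrier_mat[OF BH big_carrier(5)] big_carrier(3) stack_vec_carrier]
        assoc_mult_mat_vec[OF BH big_carrier(5) stack_vec_carrier]
        assoc_mult_mat_vec[OF big_carrier(2) big_carrier(6) c(2)] by simp
    moreover have "bigB S *\<^sub>v stack_vec ?N (nu S) (resp_u S \<chi> p E)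
        = bigB S *\<^sub>v (bigH S \<chi> *\<^sub>v (bigC S *\<^sub>v p)) + bigB S *\<^sub>v (bigH S \<chi> *\<^sub>v (bigDs S *\<^sub>v ?E))"
      unfolding HCD[symmetric] by (rule mult_add_distrib_mat_vec[OF big_carrier(2) hc])
    moreover have "dim_row (bigA S) = ?N * nx S" "dim_row (bigB S) = ?N * nx S"
        "dim_row (bigBs S) = ?N * nx S"
      using big_carrier(1-3) by blast+
    ultimately show ?thesis
      unfolding stack_resp_x
      by (intro eq_vecI) (auto simp del: index_mult_mat_vec)
  qed
  have "calBs S \<chi> *\<^sub>v eps_vec S p E
      = stack_vec ?N (nx S) (\<lambda>k. resp_x S \<chi> p E (Suc k)) @\<^sub>v stack_vec ?N (nu S) (resp_u S \<chi> p E)"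
    unfolding calBs_def eps_vec_def
    using p by (subst four_block_mat_mult_vec[of _ "?N * nx S" "nx S" _ "?N * ne S" _ "?N * nu S"])
      (auto simp: x u intro!: add_carrier_mat mult_carrier_mat[OF big_carrier(6)]
        mult_carrier_mat[OF mult_carrier_mat[OF big_carrier(2,6)]])
  moreover have "stack_vec ?N (nx S) (\<lambda>k. cl_x S \<chi> \<zeta> p E (Suc k))
      = stack_vec ?N (nx S) (\<lambda>k. cl_x S \<chi> \<zeta> (0\<^sub>v (nx S)) (\<lambda>_. 0\<^sub>v (ne S)) (Suc k))
        + stack_vec ?N (nx S) (\<lambda>k. resp_x S \<chi> p E (Suc k))"
    using p by (subst stack_vec_add[symmetric])
      (auto intro!: stack_vec_cong cl_x_response resp_x_carrier simp del: resp_x.simps)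
  moreover have "stack_vec ?N (nu S) (\<lambda>k. cl_u S \<chi> \<zeta> p E k)
      = stack_vec ?N (nu S) (\<lambda>k. cl_u S \<chi> \<zeta> (0\<^sub>v (nx S)) (\<lambda>_. 0\<^sub>v (ne S)) k) + stack_vec ?N (nu S) (resp_u S \<chi> p E)"
    by (subst stack_vec_add[symmetric]) (auto intro!: stack_vec_cong cl_u_response resp_u_carrier)
  ultimately show ?thesis
    by (simp add: traj_def append_vec_add[OF stack_vec_carrier stack_vec_carrier stack_vec_carrier stack_vec_carrier])
qed

end
end

subsection \<open>Gaussian moments and covariance\<close>

lemma pd_mats_subset_psd_mats: "pd_mats n \<subseteq> psd_mats n"
proof
  fix A assume "A \<in> pd_mats n"
  then have A: "A \<in> carrier_mat n n" "transpose_mat A = A"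
    and pos: "\<And>x. x \<in> carrier_vec n \<Longrightarrow> x \<noteq> 0\<^sub>v n \<Longrightarrow> 0 < (A *\<^sub>v x) \<bullet> x"
    by (auto simp: pd_mats_def)
  have "0 \<le> (A *\<^sub>v x) \<bullet> x" if x: "x \<in> carrier_vec n" for x
    using pos[OF x] A(1) by (cases "x = 0\<^sub>v n") (auto simp: scalar_prod_right_zero[of _ n])
  with A show "A \<in> psd_mats n" by (auto simp: psd_mats_def)
qed

lemma one_mat_psd: "1\<^sub>m n \<in> psd_mats n"
  by (auto simp: psd_mats_def scalar_prod_def intro!: sum_nonneg)

text \<open>Almost everywhere under the Dirac measure, \<open>f\<close> is the constant
  \<open>f a\<close>.\<close>

lemma has_bochner_integral_return_borel:
  fixes f :: "'a :: topological_space \<Rightarrow> real"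
  assumes [measurable]: "f \<in> borel_measurable borel"
  shows "has_bochner_integral (return borel a) f (f a)"
proof -
  interpret prob_space "return borel a" by (rule prob_space_return) simp
  have "AE x in return borel a. f x = f a" by (subst AE_return) auto
  moreover have "has_bochner_integral (return borel a) (\<lambda>_. f a) (f a)"
    using prob_space by (simp add: has_bochner_integral_iff)
  ultimately show ?thesis
    by (subst has_bochner_integral_cong_AE[where g = "\<lambda>_. f a"]) auto
qed

text \<open>For \<open>v = 0\<close> the law is the Dirac measure at 0; otherwise the moments of the
  normal density apply.\<close>

lemma normal_law_moments:
  assumes v: "v \<ge> 0"
  shows "has_bochner_integral (normal_law 0 v) (\<lambda>x. x) 0"
    and "has_bochner_integral (normal_law 0 v) (\<lambda>x. x\<^sup>2) v"
proof -
  show "has_bochner_integral (normal_law 0 v) (\<lambda>x. x) 0"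
  proof (cases "v = 0")
    case True
    then show ?thesis
      using has_bochner_integral_return_borel[of "\<lambda>x. x" 0] by (simp add: normal_law_def)
  next
    case False
    with v have "sqrt v > 0" by simp
    then have "has_bochner_integral lborel (\<lambda>x. normal_density 0 (sqrt v) x * x) 0"
      by (rule normal_moment_nz_1)
    with False show ?thesis
      by (simp add: normal_law_def has_bochner_integral_density)
  qed
  show "has_bochner_integral (normal_law 0 v) (\<lambda>x. x\<^sup>2) v"
  proof (cases "v = 0")
    case True
    then show ?thesis
      using has_bochner_integral_return_borel[of "\<lambda>x. x\<^sup>2" 0] by (simp add: normal_law_def)
  next
    case False
    with v have "sqrt v > 0" by simp
    \<comment> \<open>The even central moment of order \<open>2 * k\<close> with
      \<open>k = 1\<close>, that is, the variance.\<close>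
    from normal_moment_even[OF this, of 0 1] v
    have "has_bochner_integral lborel (\<lambda>x. normal_density 0 (sqrt v) x * x\<^sup>2) v"
      by (simp add: fact_numeral power2_eq_square[symmetric] real_sqrt_pow2)
    with False show ?thesis
      by (simp add: normal_law_def has_bochner_integral_density)
  qed
qed

lemma space_vec_borel [simp]: "space (vec_borel n) = carrier_vec n"
  by (simp add: vec_borel_def)

lemma measurable_vec_coord:
  assumes i: "i < n"
  shows "(\<lambda>v. v $ i) \<in> borel_measurable (vec_borel n)"
proof -
  have "(\<lambda>v. \<lambda>i\<in>{..<n}. v $ i) \<in> vec_borel n \<rightarrow>\<^sub>M (\<Pi>\<^sub>M i\<in>{..<n}. borel)"
    unfolding vec_borel_def by (rule measurable_vimage_algebra1) (auto simp: space_PiM)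
  from measurable_compose[OF this measurable_component_singleton[of i]] i
  show ?thesis by simp
qed

lemma measurable_scalar_prod_vec_borel:
  "(\<lambda>v. c \<bullet> v) \<in> borel_measurable (vec_borel n)"
proof -
  have "(\<lambda>v. \<Sum>i<n. c $ i * v $ i) \<in> borel_measurable (vec_borel n)"
    by (intro borel_measurable_sum borel_measurable_times measurable_const measurable_vec_coord) auto
  then show ?thesis
    by (rule measurable_cong[THEN iffD1, rotated]) (auto simp: scalar_prod_def lessThan_atLeast0)
qed

lemma gaussian_vec_carrier: "gaussian_vec M n X \<mu> \<Sigma> \<Longrightarrow> \<omega> \<in> space M \<Longrightarrow> X \<omega> \<in> carrier_vec n"
  by (auto simp: gaussian_vec_def dest!: measurable_space)

text \<open>\<open>gaussian_vec\<close> prescribes the law of each linear functional, so its moments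
  are those of \<open>normal_law\<close> carried back through \<open>distr\<close>; semidefiniteness
  makes the variance nonnegative.\<close>

lemma centered_gaussian_linear_moments:
  assumes X: "gaussian_vec M n X (0\<^sub>v n) \<Sigma>" and psd: "\<Sigma> \<in> psd_mats n" and c: "c \<in> carrier_vec n"
  shows "has_bochner_integral M (\<lambda>\<omega>. c \<bullet> X \<omega>) 0"
    and "has_bochner_integral M (\<lambda>\<omega>. (c \<bullet> X \<omega>)\<^sup>2) (c \<bullet> (\<Sigma> *\<^sub>v c))"
proof -
  have \<Sigma>c: "\<Sigma> *\<^sub>v c \<in> carrier_vec n" using psd c by (auto simp: psd_mats_def)
  have v: "0 \<le> c \<bullet> (\<Sigma> *\<^sub>v c)"
    using psd c comm_scalar_prod[OF c \<Sigma>c] by (auto simp: psd_mats_def)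
  have meas: "(\<lambda>\<omega>. c \<bullet> X \<omega>) \<in> borel_measurable M"
    using X measurable_compose[OF _ measurable_scalar_prod_vec_borel] by (auto simp: gaussian_vec_def)
  have d: "distr M borel (\<lambda>\<omega>. c \<bullet> X \<omega>) = normal_law 0 (c \<bullet> (\<Sigma> *\<^sub>v c))"
    using X c by (auto simp: gaussian_vec_def)
  show "has_bochner_integral M (\<lambda>\<omega>. c \<bullet> X \<omega>) 0"
    using normal_law_moments(1)[OF v] meas unfolding d[symmetric]
    by (simp add: has_bochner_integral_iff integrable_distr_eq integral_distr)
  show "has_bochner_integral M (\<lambda>\<omega>. (c \<bullet> X \<omega>)\<^sup>2) (c \<bullet> (\<Sigma> *\<^sub>v c))"
    using normal_law_moments(2)[OF v] meas unfolding d[symmetric]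
    by (simp add: has_bochner_integral_iff integrable_distr_eq integral_distr)
qed

text \<open>Only one-dimensional functionals are known to be normal, so the mixed moment is obtained
  by polarization from the second moments of the two entries and of their sum.\<close>

lemma centered_gaussian_moments:
  assumes X: "gaussian_vec M n X (0\<^sub>v n) \<Sigma>" and psd: "\<Sigma> \<in> psd_mats n" and i: "i < n" and j: "j < n"
  shows "has_bochner_integral M (\<lambda>\<omega>. X \<omega> $ i) 0"
    and "has_bochner_integral M (\<lambda>\<omega>. X \<omega> $ i * X \<omega> $ j) (\<Sigma> $$ (i, j))"
proof -
  have \<Sigma>: "\<Sigma> \<in> carrier_mat n n" "transpose_mat \<Sigma> = \<Sigma>" using psd by (auto simp: psd_mats_def)
  have sym: "\<Sigma> $$ (j, i) = \<Sigma> $$ (i, j)"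
    using \<Sigma> i j by (metis carrier_matD index_transpose_mat(1))
  note lin = centered_gaussian_linear_moments[OF X psd]
  have unit: "unit_vec n k \<bullet> X \<omega> = X \<omega> $ k" if "\<omega> \<in> space M" "k < n" for k \<omega>
    using gaussian_vec_carrier[OF X that(1)] that(2) by simp
  have row: "unit_vec n k \<bullet> (\<Sigma> *\<^sub>v unit_vec n l) = \<Sigma> $$ (k, l)" if "k < n" "l < n" for k l
    using that \<Sigma>(1) by (simp add: scalar_prod_left_unit[of _ n])
  show "has_bochner_integral M (\<lambda>\<omega>. X \<omega> $ i) 0"
    using lin(1)[of "unit_vec n i"] i
    by (subst has_bochner_integral_cong[OF refl unit[symmetric] refl]) auto
  have sq: "has_bochner_integral M (\<lambda>\<omega>. (X \<omega> $ k)\<^sup>2) (\<Sigma> $$ (k, k))" if k: "k < n" for k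
    using lin(2)[of "unit_vec n k"] k row[OF k k] unit[OF _ k]
    by (auto cong: has_bochner_integral_cong)
  \<comment> \<open>The functional that produces the sum of the two entries; \<open>i = j\<close> is
    allowed.\<close>
  let ?c = "unit_vec n i + unit_vec n j"
  have cX: "?c \<bullet> X \<omega> = X \<omega> $ i + X \<omega> $ j" if "\<omega> \<in> space M" for \<omega>
    using gaussian_vec_carrier[OF X that] unit[OF that] i j
    by (simp add: add_scalar_prod_distrib[of _ n])
  have U: "\<Sigma> *\<^sub>v unit_vec n k \<in> carrier_vec n" for k
    using \<Sigma>(1) by (rule mult_mat_vec_carrier) simp
  have "\<Sigma> *\<^sub>v ?c = \<Sigma> *\<^sub>v unit_vec n i + \<Sigma> *\<^sub>v unit_vec n j"
    by (rule mult_add_distrib_mat_vec[OF \<Sigma>(1)]) auto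
  then have "?c \<bullet> (\<Sigma> *\<^sub>v ?c) = \<Sigma> $$ (i, i) + \<Sigma> $$ (j, j) + 2 * \<Sigma> $$ (i, j)"
    using U row i j sym
    by (simp add: add_scalar_prod_distrib[of _ n] scalar_prod_add_distrib[of _ n] del: index_mult_mat_vec scalar_prod_left_unit scalar_prod_right_unit)
  with lin(2)[of ?c]
  have sum: "has_bochner_integral M (\<lambda>\<omega>. (X \<omega> $ i + X \<omega> $ j)\<^sup>2)
      (\<Sigma> $$ (i, i) + \<Sigma> $$ (j, j) + 2 * \<Sigma> $$ (i, j))"
    by (auto simp: cX cong: has_bochner_integral_cong)
  \<comment> \<open>Polarization: x y = ((x + y)^2 - x^2 - y^2) / 2.\<close>
  have "has_bochner_integral M
      (\<lambda>\<omega>. ((X \<omega> $ i + X \<omega> $ j)\<^sup>2 - (X \<omega> $ i)\<^sup>2 - (X \<omega> $ j)\<^sup>2) / 2)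
      ((\<Sigma> $$ (i, i) + \<Sigma> $$ (j, j) + 2 * \<Sigma> $$ (i, j) - \<Sigma> $$ (i, i) - \<Sigma> $$ (j, j)) / 2)"
    by (intro has_bochner_integral_divide_zero has_bochner_integral_diff sum sq i j)
  then show "has_bochner_integral M (\<lambda>\<omega>. X \<omega> $ i * X \<omega> $ j) (\<Sigma> $$ (i, j))"
    by (simp add: power2_sum)
qed

text \<open>Since \<open>\<epsilon>\<close> is centered, the mean is \<open>w\<close>; an entry of
  the covariance is then a double sum of second moments of \<open>\<epsilon>\<close>, which is an
  entry of the matrix product.\<close>

lemma cov_mat_affine:
  assumes M: "prob_space M" and w: "w \<in> carrier_vec n" and B: "B \<in> carrier_mat n m"
    and \<Sigma>: "\<Sigma> \<in> carrier_mat m m"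
    and X: "\<And>\<omega>. \<omega> \<in> space M \<Longrightarrow> X \<omega> = w + B *\<^sub>v \<epsilon> \<omega>"
    and \<epsilon>: "\<And>\<omega>. \<omega> \<in> space M \<Longrightarrow> \<epsilon> \<omega> \<in> carrier_vec m"
    and m1: "\<And>k. k < m \<Longrightarrow> has_bochner_integral M (\<lambda>\<omega>. \<epsilon> \<omega> $ k) 0"
    and m2: "\<And>k l. k < m \<Longrightarrow> l < m \<Longrightarrow>
      has_bochner_integral M (\<lambda>\<omega>. \<epsilon> \<omega> $ k * \<epsilon> \<omega> $ l) (\<Sigma> $$ (k, l))"
  shows "cov_mat M n X = B * \<Sigma> * transpose_mat B"
proof -
  interpret prob_space M by (rule M)
  have B\<epsilon>: "(B *\<^sub>v \<epsilon> \<omega>) $ i = (\<Sum>k<m. B $$ (i, k) * \<epsilon> \<omega> $ k)" if "\<omega> \<in> space M" "i < n" for \<omega> i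
    using \<epsilon>[OF that(1)] that(2) B by (simp add: scalar_prod_def lessThan_atLeast0)
  have E: "expect_vec M n X = w"
  proof (rule eq_vecI)
    fix i assume "i < dim_vec w"
    then have i: "i < n" using w by simp
    have "has_bochner_integral M (\<lambda>\<omega>. w $ i + (\<Sum>k<m. B $$ (i, k) * \<epsilon> \<omega> $ k))
        (measure M (space M) * w $ i + (\<Sum>k<m. B $$ (i, k) * 0))"
      by (intro has_bochner_integral_add has_bochner_integral_sum has_bochner_integral_mult_right m1)
        (auto simp: has_bochner_integral_iff)
    then have "(\<integral>\<omega>. w $ i + (\<Sum>k<m. B $$ (i, k) * \<epsilon> \<omega> $ k) \<partial>M) = w $ i"
      by (simp add: has_bochner_integral_iff prob_space)
    moreover have "(\<integral>\<omega>. X \<omega> $ i \<partial>M) = (\<integral>\<omega>. w $ i + (\<Sum>k<m. B $$ (i, k) * \<epsilon> \<omega> $ k) \<partial>M)"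
      using B i by (intro Bochner_Integration.integral_cong) (simp_all add: X B\<epsilon> del: index_mult_mat_vec)
    ultimately show "expect_vec M n X $ i = w $ i"
      using i by (simp add: expect_vec_def)
  qed (use w in \<open>simp add: expect_vec_def\<close>)
  show ?thesis
  proof (rule eq_matI)
    fix i j assume "i < dim_row (B * \<Sigma> * transpose_mat B)" "j < dim_col (B * \<Sigma> * transpose_mat B)"
    then have i: "i < n" and j: "j < n" using B by auto
    have "(col_mat (X \<omega> - w) * transpose_mat (col_mat (X \<omega> - w))) $$ (i, j)
        = (\<Sum>k<m. \<Sum>l<m. B $$ (i, k) * B $$ (j, l) * (\<epsilon> \<omega> $ k * \<epsilon> \<omega> $ l))" if \<omega>: "\<omega> \<in> space M" for \<omega>
    proof -
      have "(X \<omega> - w) $ a = (\<Sum>k<m. B $$ (a, k) * \<epsilon> \<omega> $ k)" if "a < n" for a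
        using w B that \<omega> by (simp add: X B\<epsilon> del: index_mult_mat_vec)
      moreover have "dim_vec (X \<omega> - w) = n" using w by simp
      ultimately have "(col_mat (X \<omega> - w) * transpose_mat (col_mat (X \<omega> - w))) $$ (i, j)
          = (\<Sum>k<m. B $$ (i, k) * \<epsilon> \<omega> $ k) * (\<Sum>l<m. B $$ (j, l) * \<epsilon> \<omega> $ l)"
        using i j by (simp add: col_mat_def mat_of_cols_def scalar_prod_def del: index_minus_vec)
      then show ?thesis by (simp add: sum_product mult_ac)
    qed
    then have "cov_mat M n X $$ (i, j)
        = (\<integral>\<omega>. (\<Sum>k<m. \<Sum>l<m. B $$ (i, k) * B $$ (j, l) * (\<epsilon> \<omega> $ k * \<epsilon> \<omega> $ l)) \<partial>M)"
      using i j by (simp add: cov_mat_def expect_mat_def E cong: Bochner_Integration.integral_cong)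
    also have "\<dots> = (\<Sum>k<m. \<Sum>l<m. B $$ (i, k) * B $$ (j, l) * \<Sigma> $$ (k, l))"
      by (intro has_bochner_integral_integral_eq has_bochner_integral_sum has_bochner_integral_mult_right m2) auto
    also have "\<dots> = (\<Sum>k<m. B $$ (i, k) * (\<Sum>l<m. \<Sigma> $$ (k, l) * B $$ (j, l)))"
      by (simp add: sum_distrib_left mult_ac)
    also have "\<dots> = (B * \<Sigma> * transpose_mat B) $$ (i, j)"
      using B \<Sigma> i j by (simp add: scalar_prod_def lessThan_atLeast0)
    finally show "cov_mat M n X $$ (i, j) = (B * \<Sigma> * transpose_mat B) $$ (i, j)" .
  qed (use B in \<open>auto simp: cov_mat_def expect_mat_def\<close>)
qed

text \<open>Independence turns the expectation of the product into the product of the expectations,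
  both of which vanish.\<close>

lemma noise_product_moment:
  assumes M: "prob_space M" and ind: "prob_space.indep_vars M (\<lambda>k. vec_borel (d k)) Z I"
    and ab: "a \<in> I" "b \<in> I" "a \<noteq> b" and ij: "i < d a" "j < d b"
    and mi: "has_bochner_integral M (\<lambda>\<omega>. Z a \<omega> $ i) 0"
    and mj: "has_bochner_integral M (\<lambda>\<omega>. Z b \<omega> $ j) 0"
  shows "has_bochner_integral M (\<lambda>\<omega>. Z a \<omega> $ i * Z b \<omega> $ j) 0"
proof -
  interpret prob_space M by (rule M)
  \<comment> \<open>Selects one coordinate per noise vector, so that the product of the two entries
    is a product over the set \<open>{a, b}\<close>.\<close>
  define r where "r k = (if k = a then i else j)" for k
  have "indep_vars (\<lambda>k. vec_borel (d k)) Z {a, b}"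
    using ind ab by (intro indep_vars_subset[OF ind]) auto
  then have *: "indep_vars (\<lambda>k. borel) (\<lambda>k \<omega>. Z k \<omega> $ r k) {a, b}"
    using ij ab by (intro indep_vars_compose2[where M' = "\<lambda>k. vec_borel (d k)" and X = Z and Y = "\<lambda>k v. v $ r k"])
      (auto simp: r_def intro: measurable_vec_coord)
  have int: "integrable M (\<lambda>\<omega>. Z k \<omega> $ r k)" if "k \<in> {a, b}" for k
    using that mi mj ab by (auto simp: r_def has_bochner_integral_iff)
  have "integrable M (\<lambda>\<omega>. \<Prod>k\<in>{a, b}. Z k \<omega> $ r k)"
    by (rule indep_vars_integrable[OF _ * int]) simp_all
  moreover have "(\<integral>\<omega>. (\<Prod>k\<in>{a, b}. Z k \<omega> $ r k) \<partial>M) = (\<Prod>k\<in>{a, b}. \<integral>\<omega>. Z k \<omega> $ r k \<partial>M)"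
    by (rule indep_vars_lebesgue_integral[OF _ * int]) simp_all
  ultimately show ?thesis
    using ab mi mj by (simp add: has_bochner_integral_iff r_def)
qed

subsection \<open>Convexity of the matrix inequality\<close>

lemma scalar_prod_mult_mat_vec:
  assumes "A \<in> carrier_mat n n" "x \<in> carrier_vec n" "y \<in> carrier_vec n"
  shows "(A *\<^sub>v x) \<bullet> y = (\<Sum>i<n. \<Sum>j<n. A $$ (i, j) * (x $ j * y $ i) :: real)"
  using assms by (simp add: scalar_prod_def lessThan_atLeast0 sum_distrib_left sum_distrib_right mult_ac)

text \<open>The two sides differ by exactly \<open>a b \<langle>A (x - y), x - y\<rangle>\<close>.\<close>

lemma psd_quadratic_form_convex:
  assumes psd: "A \<in> psd_mats n" and x: "x \<in> carrier_vec n" and y: "y \<in> carrier_vec n"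
    and a: "0 \<le> a" and b: "0 \<le> b" and ab: "a + b = 1"
  shows "(A *\<^sub>v (a \<cdot>\<^sub>v x + b \<cdot>\<^sub>v y)) \<bullet> (a \<cdot>\<^sub>v x + b \<cdot>\<^sub>v y)
     \<le> a * ((A *\<^sub>v x) \<bullet> x) + b * ((A *\<^sub>v y) \<bullet> y)"
proof -
  have A: "A \<in> carrier_mat n n" using psd by (simp add: psd_mats_def)
  let ?z = "a \<cdot>\<^sub>v x + b \<cdot>\<^sub>v y"
  have z: "?z \<in> carrier_vec n" using x y by simp
  have b_eq: "b = 1 - a" using ab by simp
  have "a * ((A *\<^sub>v x) \<bullet> x) + b * ((A *\<^sub>v y) \<bullet> y) - (A *\<^sub>v ?z) \<bullet> ?z
      = (\<Sum>i<n. \<Sum>j<n. A $$ (i, j) * (a * (x $ j * x $ i) + b * (y $ j * y $ i) - ?z $ j * ?z $ i))"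
    unfolding scalar_prod_mult_mat_vec[OF A x x] scalar_prod_mult_mat_vec[OF A y y]
      scalar_prod_mult_mat_vec[OF A z z]
    by (simp add: sum_distrib_left sum_subtractf sum.distrib algebra_simps del: index_add_vec index_smult_vec)
  also have "\<dots> = (\<Sum>i<n. \<Sum>j<n. a * b * (A $$ (i, j) * ((x - y) $ j * (x - y) $ i)))"
  proof (intro sum.cong refl)
    fix i j assume "i \<in> {..<n}" "j \<in> {..<n}"
    then show "A $$ (i, j) * (a * (x $ j * x $ i) + b * (y $ j * y $ i) - ?z $ j * ?z $ i)
        = a * b * (A $$ (i, j) * ((x - y) $ j * (x - y) $ i))"
      using x y by (simp add: b_eq algebra_simps)
  qed
  also have "\<dots> = a * b * ((A *\<^sub>v (x - y)) \<bullet> (x - y))"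
    using x y A by (simp add: scalar_prod_mult_mat_vec[of _ n] sum_distrib_left del: index_minus_vec)
  also have "\<dots> \<ge> 0"
    using psd a b x y by (auto simp: psd_mats_def)
  finally show ?thesis by simp
qed

text \<open>Both sides are symmetric, so the matrix inequality amounts to one scalar inequality per
  \<open>x\<close>. In each of them \<open>R\<close> occurs only through
  \<open>transpose_mat R *\<^sub>v x\<close>, where convexity can be applied.\<close>

lemma loewner_le_congruence_iff:
  assumes R: "R \<in> carrier_mat k m" and \<Sigma>: "\<Sigma> \<in> psd_mats m" and T: "T \<in> psd_mats k"
  shows "loewner_le k (R * \<Sigma> * transpose_mat R) T \<longleftrightarrow>
    (\<forall>x \<in> carrier_vec k. (\<Sigma> *\<^sub>v (transpose_mat R *\<^sub>v x)) \<bullet> (transpose_mat R *\<^sub>v x) \<le> (T *\<^sub>v x) \<bullet> x)"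
proof -
  let ?P = "R * \<Sigma> * transpose_mat R"
  have S: "\<Sigma> \<in> carrier_mat m m" "transpose_mat \<Sigma> = \<Sigma>" and Tc: "T \<in> carrier_mat k k" "transpose_mat T = T"
    using \<Sigma> T by (auto simp: psd_mats_def)
  have Rt: "transpose_mat R \<in> carrier_mat m k" using R by simp
  have RS: "R * \<Sigma> \<in> carrier_mat k m" using R S(1) by (rule mult_carrier_mat)
  have P: "?P \<in> carrier_mat k k" using RS Rt by (rule mult_carrier_mat)
  have Psym: "transpose_mat ?P = ?P"
    using transpose_mult[OF RS Rt] transpose_mult[OF R S(1)] S(2) assoc_mult_mat[OF R S(1) Rt] by simp
  have sym: "transpose_mat (T - ?P) = T - ?P"
  proof (rule eq_matI)
    fix i j assume ij: "i < dim_row (T - ?P)" "j < dim_col (T - ?P)"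
    then have "i < k" "j < k" using P by auto
    moreover have "?P $$ (j, i) = ?P $$ (i, j)"
      using \<open>i < k\<close> \<open>j < k\<close> P by (metis Psym carrier_matD index_transpose_mat(1))
    moreover have "T $$ (j, i) = T $$ (i, j)"
      using \<open>i < k\<close> \<open>j < k\<close> Tc by (metis carrier_matD index_transpose_mat(1))
    ultimately show "transpose_mat (T - ?P) $$ (i, j) = (T - ?P) $$ (i, j)"
      using \<open>i < k\<close> \<open>j < k\<close> carrier_matD[OF P] carrier_matD[OF Tc(1)]
      by (simp del: index_mult_mat)
  qed (use P in auto)
  have quad: "((T - ?P) *\<^sub>v x) \<bullet> x = (T *\<^sub>v x) \<bullet> x
      - (\<Sigma> *\<^sub>v (transpose_mat R *\<^sub>v x)) \<bullet> (transpose_mat R *\<^sub>v x)" if x: "x \<in> carrier_vec k" for x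
  proof -
    let ?y = "transpose_mat R *\<^sub>v x"
    have y: "?y \<in> carrier_vec m" using Rt x by (rule mult_mat_vec_carrier)
    have Sy: "\<Sigma> *\<^sub>v ?y \<in> carrier_vec m" using S(1) y by (rule mult_mat_vec_carrier)
    have "?P *\<^sub>v x = R *\<^sub>v (\<Sigma> *\<^sub>v ?y)"
      using assoc_mult_mat_vec[OF RS Rt x] assoc_mult_mat_vec[OF R S(1) y] by simp
    \<comment> \<open>\<open>R\<close> moves to the other side of the inner product as its
      transpose.\<close>
    moreover have "(R *\<^sub>v (\<Sigma> *\<^sub>v ?y)) \<bullet> x = (\<Sigma> *\<^sub>v ?y) \<bullet> ?y"
      using transpose_vec_mult_scalar[OF Rt x Sy] by simp
    moreover have "((T - ?P) *\<^sub>v x) \<bullet> x = (T *\<^sub>v x) \<bullet> x - (?P *\<^sub>v x) \<bullet> x"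
      using minus_mult_distrib_mat_vec[OF Tc(1) P x]
        minus_scalar_prod_distrib[OF mult_mat_vec_carrier[OF Tc(1) x] mult_mat_vec_carrier[OF P x] x] by simp
    ultimately show ?thesis by simp
  qed
  show ?thesis
    unfolding loewner_le_def psd_mats_def using P Tc sym by (auto simp: quad minus_carrier_mat)
qed

section \<open>Affine dependence of \<open>calBs\<close> on the policy parameters\<close>

lemma mult_mat_lincomb:
  fixes A :: "real mat"
  assumes A: "A \<in> carrier_mat r m" and X: "X \<in> carrier_mat m c" and Y: "Y \<in> carrier_mat m c"
  shows "A * (a \<cdot>\<^sub>m X + b \<cdot>\<^sub>m Y) = a \<cdot>\<^sub>m (A * X) + b \<cdot>\<^sub>m (A * Y)"
  using mult_add_distrib_mat[OF A, of "a \<cdot>\<^sub>m X" c "b \<cdot>\<^sub>m Y"] X Y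
  by (simp add: mult_smult_distrib[OF A])

lemma lincomb_mat_mult:
  fixes A :: "real mat"
  assumes A: "A \<in> carrier_mat m c" and X: "X \<in> carrier_mat r m" and Y: "Y \<in> carrier_mat r m"
  shows "(a \<cdot>\<^sub>m X + b \<cdot>\<^sub>m Y) * A = a \<cdot>\<^sub>m (X * A) + b \<cdot>\<^sub>m (Y * A)"
  using add_mult_distrib_mat[OF smult_carrier_mat[OF X] smult_carrier_mat[OF Y] A]
  by (simp add: mult_smult_assoc_mat[OF X A] mult_smult_assoc_mat[OF Y A])

lemma smult_mat_mult_vec:
  fixes A :: "real mat"
  assumes "A \<in> carrier_mat r c" "x \<in> carrier_vec c"
  shows "(a \<cdot>\<^sub>m A) *\<^sub>v x = a \<cdot>\<^sub>v (A *\<^sub>v x)"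
  using assms by (intro eq_vecI) auto

text \<open>Time \<open>t\<close> owns a segment of \<open>nu S + (t + 1) * (nu S * ny S)\<close>
  entries, and \<open>i \<le> t\<close> keeps the matrix number \<open>i\<close> inside it. The
  bound matters because entries of a vector sum can be added only below the dimension.\<close>

lemma chi_index_less:
  assumes t: "t < horizon S" and i: "i \<le> t" and k: "k < nu S" and l: "l < ny S"
  shows "chi_offset S t + nu S + i * (nu S * ny S) + k * ny S + l < n_chi S"
proof -
  have "k * ny S + l < Suc k * ny S" using l by simp
  also have "\<dots> \<le> nu S * ny S" using k by (intro mult_le_mono1) simp
  finally have "i * (nu S * ny S) + (k * ny S + l) < Suc i * (nu S * ny S)" by simp
  also have "\<dots> \<le> (t + 1) * (nu S * ny S)" using i by (intro mult_le_mono1) simp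
  finally have "chi_offset S t + nu S + i * (nu S * ny S) + k * ny S + l < chi_offset S (Suc t)"
    by (simp add: chi_offset_def)
  also have "\<dots> \<le> n_chi S"
    unfolding n_chi_def chi_offset_def using t by (intro sum_mono2) auto
  finally show ?thesis .
qed

text \<open>Each entry of \<open>bigH\<close> is either zero or the entry of \<open>\<chi>\<close>
  at a fixed position, hence linear in \<open>\<chi>\<close>.\<close>

lemma bigH_lincomb:
  assumes x: "\<chi> \<in> carrier_vec (n_chi S)" and y: "\<chi>' \<in> carrier_vec (n_chi S)"
  shows "bigH S (a \<cdot>\<^sub>v \<chi> + b \<cdot>\<^sub>v \<chi>') = a \<cdot>\<^sub>m bigH S \<chi> + b \<cdot>\<^sub>m bigH S \<chi>'"
proof (rule eq_matI)
  let ?N = "horizon S"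
  fix i j assume "i < dim_row (a \<cdot>\<^sub>m bigH S \<chi> + b \<cdot>\<^sub>m bigH S \<chi>')"
    "j < dim_col (a \<cdot>\<^sub>m bigH S \<chi> + b \<cdot>\<^sub>m bigH S \<chi>')"
  then have i: "i < ?N * nu S" and j: "j < ?N * ny S" by (auto simp: bigH_def block_mat_def)
  have b: "i div nu S < ?N" "i mod nu S < nu S" "j div ny S < ?N" "j mod ny S < ny S"
    using i j mod_less_of_less_mult[OF i] mod_less_of_less_mult[OF j] by (auto simp: less_mult_imp_div_less)
  show "bigH S (a \<cdot>\<^sub>v \<chi> + b \<cdot>\<^sub>v \<chi>') $$ (i, j) = (a \<cdot>\<^sub>m bigH S \<chi> + b \<cdot>\<^sub>m bigH S \<chi>') $$ (i, j)"
    using i j b x y chi_index_less[OF b(1) _ b(2) b(4)]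
    by (auto simp: bigH_def block_mat_def pol_H_def)
qed (auto simp: bigH_def block_mat_def)

lemma calBs_carrier [simp]:
  "calBs S \<chi> \<in> carrier_mat (n_w S) (nx S + horizon S * ne S)"
  unfolding calBs_def n_w_def mult.commute[of _ "horizon S"]
  by (intro four_block_carrier_mat add_carrier_mat mult_carrier_mat[OF big_carrier(6)] big_carrier)

text \<open>\<open>calBs\<close> is affine rather than linear: the summands \<open>bigA\<close> and
  \<open>bigBs\<close> are constant, and the combination reproduces them because
  \<open>a + b = 1\<close>.\<close>

lemma calBs_lincomb:
  assumes x: "\<chi> \<in> carrier_vec (n_chi S)" and y: "\<chi>' \<in> carrier_vec (n_chi S)"
    and ab: "a + b = 1"
  shows "calBs S (a \<cdot>\<^sub>v \<chi> + b \<cdot>\<^sub>v \<chi>') = a \<cdot>\<^sub>m calBs S \<chi> + b \<cdot>\<^sub>m calBs S \<chi>'"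
proof -
  let ?H = "bigH S \<chi>" and ?K = "bigH S \<chi>'"
  note c = big_carrier
  note BH = mult_carrier_mat[OF c(2) c(6)]
  \<comment> \<open>Here \<open>r\<close> stands for an entry of a constant summand, distributed
    with weights \<open>a\<close> and \<open>b\<close>.\<close>
  have fin: "a * p + b * q + r = a * (p + r) + b * (q + r)" for p q r :: real
    using arg_cong[OF ab, of "\<lambda>t. t * r"] by (simp add: algebra_simps)
  have H: "bigH S (a \<cdot>\<^sub>v \<chi> + b \<cdot>\<^sub>v \<chi>') = a \<cdot>\<^sub>m ?H + b \<cdot>\<^sub>m ?K"
    by (rule bigH_lincomb[OF x y])
  have 1: "bigB S * (a \<cdot>\<^sub>m ?H + b \<cdot>\<^sub>m ?K) = a \<cdot>\<^sub>m (bigB S * ?H) + b \<cdot>\<^sub>m (bigB S * ?K)"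
    by (rule mult_mat_lincomb[OF c(2) c(6) c(6)])
  note 2 = lincomb_mat_mult[OF c(4) BH BH] lincomb_mat_mult[OF c(5) BH BH]
    lincomb_mat_mult[OF c(4) c(6) c(6)] lincomb_mat_mult[OF c(5) c(6) c(6)]
  note d = carrier_matD[OF c(1)] carrier_matD[OF c(2)] carrier_matD[OF c(3)] carrier_matD[OF c(4)]
    carrier_matD[OF c(5)] carrier_matD[OF c(6)]
  show ?thesis
    unfolding calBs_def H 1 2
    by (rule eq_matI) (auto simp: d fin index_mult_mat(2,3) simp del: index_mult_mat(1))
qed

section \<open>The stacked noise and the covariance of the trajectory\<close>

text \<open>The matrix is block diagonal, so its quadratic form splits into that of
  \<open>\<Sigma>0\<close> on the first part and the squared norm of the rest.\<close>

lemma Sigma_eps_psd: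
  assumes \<Sigma>0: "\<Sigma>0 \<in> psd_mats (nx S)"
  shows "Sigma_eps S \<Sigma>0 \<in> psd_mats (nx S + horizon S * ne S)"
proof -
  let ?n = "nx S" and ?m = "horizon S * ne S"
  have c: "\<Sigma>0 \<in> carrier_mat ?n ?n" "transpose_mat \<Sigma>0 = \<Sigma>0" using \<Sigma>0 by (auto simp: psd_mats_def)
  have "0 \<le> (Sigma_eps S \<Sigma>0 *\<^sub>v x) \<bullet> x" if x: "x \<in> carrier_vec (?n + ?m)" for x
  proof -
    let ?p = "vec_first x ?n" and ?q = "vec_last x ?m"
    have "(Sigma_eps S \<Sigma>0 *\<^sub>v (?p @\<^sub>v ?q)) \<bullet> (?p @\<^sub>v ?q) = (\<Sigma>0 *\<^sub>v ?p) \<bullet> ?p + ?q \<bullet> ?q"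
      unfolding Sigma_eps_def mult_mat_vec_split[OF c(1) one_carrier_mat vec_first_carrier vec_last_carrier]
      using scalar_prod_append[OF mult_mat_vec_carrier[OF c(1) vec_first_carrier] vec_last_carrier
          vec_first_carrier vec_last_carrier]
      by simp
    also have "\<dots> \<ge> 0"
      using \<Sigma>0 by (auto simp: psd_mats_def scalar_prod_def[of ?q] intro!: add_nonneg_nonneg sum_nonneg)
    finally show ?thesis using x by simp
  qed
  moreover have "transpose_mat (Sigma_eps S \<Sigma>0) = Sigma_eps S \<Sigma>0"
    unfolding Sigma_eps_def using c(1)
    by (subst transpose_four_block_mat[OF c(1) zero_carrier_mat zero_carrier_mat one_carrier_mat]) (simp add: c(2))
  moreover have "Sigma_eps S \<Sigma>0 \<in> carrier_mat (?n + ?m) (?n + ?m)"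
    unfolding Sigma_eps_def by (rule four_block_carrier_mat[OF c(1) one_carrier_mat])
  ultimately show ?thesis by (auto simp: psd_mats_def)
qed

text \<open>The \<open>k\<close>-th entry of \<open>\<epsilon>\<close> is entry \<open>noise_coord S k\<close> of the noise vector with number
  \<open>noise_index S k\<close> in the sequence \<open>s\<^sub>0, e\<^sub>0, e\<^sub>1, \<dots>\<close>.\<close>

definition noise_index :: "lin_sys \<Rightarrow> nat \<Rightarrow> nat" where
  "noise_index S k = (if k < nx S then 0 else Suc ((k - nx S) div ne S))"

definition noise_coord :: "lin_sys \<Rightarrow> nat \<Rightarrow> nat" where
  "noise_coord S k = (if k < nx S then k else (k - nx S) mod ne S)"

text \<open>Covariance matrix of the noise vector with number \<open>b\<close> in the sequence
  \<open>noise\<close>.\<close>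

definition noise_cov :: "lin_sys \<Rightarrow> real mat \<Rightarrow> nat \<Rightarrow> real mat" where
  "noise_cov S \<Sigma>0 b = (case b of 0 \<Rightarrow> \<Sigma>0 | Suc _ \<Rightarrow> 1\<^sub>m (ne S))"

lemma noise_index_bounds:
  assumes "k < nx S + horizon S * ne S"
  shows "noise_index S k \<le> horizon S" "noise_coord S k < noise_dim S (noise_index S k)"
proof -
  have "k - nx S < horizon S * ne S" if "\<not> k < nx S" using assms that by auto
  then show "noise_index S k \<le> horizon S" "noise_coord S k < noise_dim S (noise_index S k)"
    by (auto simp: noise_index_def noise_coord_def noise_dim_def Suc_le_eq less_mult_imp_div_less
        dest: mod_less_of_less_mult)
qed

lemma eps_vec_index:
  assumes "s0 \<omega> \<in> carrier_vec (nx S)" and k: "k < nx S + horizon S * ne S"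
  shows "eps_vec S (s0 \<omega>) (\<lambda>t. e t \<omega>) $ k = noise s0 e (noise_index S k) \<omega> $ noise_coord S k"
proof -
  have "k - nx S < horizon S * ne S" if "\<not> k < nx S" using k that by auto
  with assms show ?thesis
    by (auto simp: eps_vec_def stack_vec_def noise_def noise_index_def noise_coord_def)
qed

text \<open>The large identity block is itself block diagonal with one identity per e_t. This form
  matches the split into entries of one noise vector and entries of two independent ones.\<close>

lemma Sigma_eps_index:
  assumes \<Sigma>0: "\<Sigma>0 \<in> carrier_mat (nx S) (nx S)"
    and k: "k < nx S + horizon S * ne S" and l: "l < nx S + horizon S * ne S"
  shows "Sigma_eps S \<Sigma>0 $$ (k, l) =
    (if noise_index S k = noise_index S l
     then noise_cov S \<Sigma>0 (noise_index S k) $$ (noise_coord S k, noise_coord S l) else 0)"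
proof -
  let ?n = "nx S" and ?m = "ne S"
  have c: "dim_row \<Sigma>0 = ?n" "dim_col \<Sigma>0 = ?n" using \<Sigma>0 by auto
  show ?thesis
  proof (cases "k < ?n \<or> l < ?n")
    case True
    then show ?thesis
      using k l by (auto simp: Sigma_eps_def c noise_cov_def noise_index_def noise_coord_def)
  next
    case False
    define k' l' where "k' = k - ?n" and "l' = l - ?n"
    have kl: "k = ?n + k'" "l = ?n + l'" using False by (auto simp: k'_def l'_def)
    have b: "k' < horizon S * ?m" "l' < horizon S * ?m" using k l by (auto simp: kl)
    \<comment> \<open>Inside the identity block, equal flat indices mean equal noise vector and
      equal coordinate.\<close>
    have "k' = l' \<longleftrightarrow> k' div ?m = l' div ?m \<and> k' mod ?m = l' mod ?m"
      by (metis div_mult_mod_eq)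
    then show ?thesis
      using b mod_less_of_less_mult[OF b(1)] mod_less_of_less_mult[OF b(2)]
      by (simp add: Sigma_eps_def c noise_cov_def noise_index_def noise_coord_def kl)
  qed
qed

lemma noise_model_gaussian:
  assumes "noise_model M S \<Sigma>0 s0 e" and "b \<le> horizon S"
  shows "gaussian_vec M (noise_dim S b) (noise s0 e b) (0\<^sub>v (noise_dim S b)) (noise_cov S \<Sigma>0 b)"
  using assms by (cases b) (auto simp: noise_model_def noise_dim_def noise_def noise_cov_def)

lemma noise_cov_psd:
  "\<Sigma>0 \<in> psd_mats (nx S) \<Longrightarrow> noise_cov S \<Sigma>0 b \<in> psd_mats (noise_dim S b)"
  by (cases b) (auto simp: noise_cov_def noise_dim_def one_mat_psd)

text \<open>By \<open>traj_response\<close>, \<open>\<zeta>\<close> shifts only the mean of the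
  trajectory, and the noise enters through \<open>calBs\<close>; it remains to identify the moments
  of the stacked noise.\<close>

lemma Sigma_w_eq:
  assumes M: "prob_space M" and wf: "wf_sys S" and \<Sigma>0: "\<Sigma>0 \<in> psd_mats (nx S)"
    and nm: "noise_model M S \<Sigma>0 s0 e"
  shows "Sigma_w M S s0 e \<chi> \<zeta> = calBs S \<chi> * Sigma_eps S \<Sigma>0 * transpose_mat (calBs S \<chi>)"
proof -
  let ?m = "nx S + horizon S * ne S"
  let ?\<epsilon> = "\<lambda>\<omega>. eps_vec S (s0 \<omega>) (\<lambda>t. e t \<omega>)"
  note G = noise_model_gaussian[OF nm]
  have s0: "s0 \<omega> \<in> carrier_vec (nx S)" if "\<omega> \<in> space M" for \<omega>
    using gaussian_vec_carrier[OF G[of 0] that] by (simp add: noise_def noise_dim_def)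
  have e: "e t \<omega> \<in> carrier_vec (ne S)" if "\<omega> \<in> space M" "t < horizon S" for t \<omega>
    using gaussian_vec_carrier[OF G[of "Suc t"] that(1)] that(2) by (simp add: noise_def noise_dim_def)
  have \<epsilon>: "?\<epsilon> \<omega> \<in> carrier_vec ?m" if "\<omega> \<in> space M" for \<omega>
    using s0[OF that] by (auto simp: eps_vec_def)
  have \<epsilon>_index: "?\<epsilon> \<omega> $ k = noise s0 e (noise_index S k) \<omega> $ noise_coord S k"
    if "\<omega> \<in> space M" "k < ?m" for \<omega> k
    using that s0 by (intro eps_vec_index) auto
  have m1: "has_bochner_integral M (\<lambda>\<omega>. noise s0 e (noise_index S k) \<omega> $ noise_coord S k) 0"
    if "k < ?m" for k
    using noise_index_bounds[OF that]
    by (intro centered_gaussian_moments(1)[OF G noise_cov_psd[OF \<Sigma>0]])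
  have m2: "has_bochner_integral M
      (\<lambda>\<omega>. noise s0 e (noise_index S k) \<omega> $ noise_coord S k * noise s0 e (noise_index S l) \<omega> $ noise_coord S l)
      (Sigma_eps S \<Sigma>0 $$ (k, l))" if k: "k < ?m" and l: "l < ?m" for k l
  proof (cases "noise_index S k = noise_index S l")
    case True
    \<comment> \<open>Both entries belong to the same noise vector, so its own covariance
      applies.\<close>
    have "has_bochner_integral M
      (\<lambda>\<omega>. noise s0 e (noise_index S k) \<omega> $ noise_coord S k * noise s0 e (noise_index S k) \<omega> $ noise_coord S l)
      (noise_cov S \<Sigma>0 (noise_index S k) $$ (noise_coord S k, noise_coord S l))"
      using noise_index_bounds[OF k] noise_index_bounds[OF l] True
      by (intro centered_gaussian_moments(2)[OF G noise_cov_psd[OF \<Sigma>0]]) auto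
    with True show ?thesis
      using \<Sigma>0 k l by (simp add: Sigma_eps_index psd_mats_def)
  next
    case False
    \<comment> \<open>Different noise vectors are independent and centered, which matches a zero
      entry of \<open>Sigma_eps\<close>.\<close>
    have "has_bochner_integral M
      (\<lambda>\<omega>. noise s0 e (noise_index S k) \<omega> $ noise_coord S k * noise s0 e (noise_index S l) \<omega> $ noise_coord S l) 0"
      using nm noise_index_bounds[OF k] noise_index_bounds[OF l] False
      by (intro noise_product_moment[where d = "noise_dim S" and I = "{0..horizon S}"] M m1 k l)
        (auto simp: noise_model_def)
    with False show ?thesis
      using \<Sigma>0 k l by (simp add: Sigma_eps_index psd_mats_def)
  qed
  have traj_c: "traj S \<chi> \<zeta> p E \<in> carrier_vec (n_w S)" for p E
    by (auto simp: traj_def n_w_def mult.commute[of _ "horizon S"])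
  show ?thesis
    unfolding Sigma_w_def
  proof (rule cov_mat_affine[OF M traj_c calBs_carrier, where \<epsilon> = ?\<epsilon>])
    show "Sigma_eps S \<Sigma>0 \<in> carrier_mat ?m ?m"
      using Sigma_eps_psd[OF \<Sigma>0] by (simp add: psd_mats_def)
    show "traj S \<chi> \<zeta> (s0 \<omega>) (\<lambda>t. e t \<omega>)
        = traj S \<chi> \<zeta> (0\<^sub>v (nx S)) (\<lambda>_. 0\<^sub>v (ne S)) + calBs S \<chi> *\<^sub>v ?\<epsilon> \<omega>" if "\<omega> \<in> space M" for \<omega>
      using that by (intro traj_response[OF wf] s0 e)
    show "has_bochner_integral M (\<lambda>\<omega>. ?\<epsilon> \<omega> $ k) 0" if "k < ?m" for k
      using m1[OF that] that by (simp add: \<epsilon>_index cong: has_bochner_integral_cong)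
    show "has_bochner_integral M (\<lambda>\<omega>. ?\<epsilon> \<omega> $ k * ?\<epsilon> \<omega> $ l) (Sigma_eps S \<Sigma>0 $$ (k, l))"
      if "k < ?m" "l < ?m" for k l
      using m2[OF that] that by (simp add: \<epsilon>_index cong: has_bochner_integral_cong)
  qed (rule \<epsilon>)
qed

section \<open>The robust constraint and the convex feasible set\<close>

text \<open>Keeps the quantifier over \<open>\<zeta>\<close> from being vacuous, so that the robust
  constraint implies the matrix inequality.\<close>

lemma zero_in_uncertainty_set:
  assumes "\<And>i. i \<in> {1..s} \<Longrightarrow> Q i \<in> psd_mats (n_zeta S)"
  shows "0\<^sub>v (n_zeta S) \<in> uncertainty_set S s Q"
proof -
  have "(Q i *\<^sub>v 0\<^sub>v (n_zeta S)) \<bullet> 0\<^sub>v (n_zeta S) = 0" if "i \<in> {1..s}" for i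
  proof -
    have "Q i \<in> carrier_mat (n_zeta S) (n_zeta S)" using assms[OF that] by (simp add: psd_mats_def)
    then show ?thesis by (intro scalar_prod_right_zero mult_mat_vec_carrier) auto
  qed
  then show ?thesis by (simp add: uncertainty_set_def)
qed

text \<open>The feasible set is an intersection over \<open>x\<close> of sublevel sets:
  \<open>?y \<chi> x\<close> is affine in \<open>\<chi>\<close>, \<open>?q\<close> is convex, and
  the bound depends on \<open>x\<close> alone.\<close>

lemma convex_covariance_constraint:
  assumes \<Sigma>: "\<Sigma> \<in> psd_mats (nx S + horizon S * ne S)"
    and Q: "Q \<in> carrier_mat k (n_w S)" and T: "T \<in> psd_mats k"
  shows "convex_vecs {\<chi> \<in> carrier_vec (n_chi S).
    loewner_le k ((Q * calBs S \<chi>) * \<Sigma> * transpose_mat (Q * calBs S \<chi>)) T}"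
proof -
  let ?m = "nx S + horizon S * ne S"
  let ?y = "\<lambda>\<chi> x. transpose_mat (Q * calBs S \<chi>) *\<^sub>v x"
  let ?q = "\<lambda>y. (\<Sigma> *\<^sub>v y) \<bullet> y"
  have R: "Q * calBs S \<chi> \<in> carrier_mat k ?m" for \<chi>
    using Q calBs_carrier by (rule mult_carrier_mat)
  have Rt: "transpose_mat (Q * calBs S \<chi>) \<in> carrier_mat ?m k" for \<chi>
    using R by simp
  note iff = loewner_le_congruence_iff[OF R \<Sigma> T]
  show ?thesis
    unfolding convex_vecs_def mem_Collect_eq iff
  proof (intro ballI allI impI conjI, goal_cases)
    case (1 \<chi> \<chi>' a b)
    then show ?case by auto
  next
    case (2 \<chi> \<chi>' a b x)
    then have c: "\<chi> \<in> carrier_vec (n_chi S)" "\<chi>' \<in> carrier_vec (n_chi S)"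
      and ab: "0 \<le> a" "0 \<le> b" "a + b = 1" and x: "x \<in> carrier_vec k"
      and q: "?q (?y \<chi> x) \<le> (T *\<^sub>v x) \<bullet> x" "?q (?y \<chi>' x) \<le> (T *\<^sub>v x) \<bullet> x"
      by auto
    have yc: "?y \<chi> x \<in> carrier_vec ?m" for \<chi> using Rt x by (rule mult_mat_vec_carrier)
    have "Q * calBs S (a \<cdot>\<^sub>v \<chi> + b \<cdot>\<^sub>v \<chi>') = a \<cdot>\<^sub>m (Q * calBs S \<chi>) + b \<cdot>\<^sub>m (Q * calBs S \<chi>')"
      unfolding calBs_lincomb[OF c ab(3)] by (rule mult_mat_lincomb[OF Q calBs_carrier calBs_carrier])
    then have "transpose_mat (Q * calBs S (a \<cdot>\<^sub>v \<chi> + b \<cdot>\<^sub>v \<chi>'))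
        = a \<cdot>\<^sub>m transpose_mat (Q * calBs S \<chi>) + b \<cdot>\<^sub>m transpose_mat (Q * calBs S \<chi>')"
      using carrier_matD[OF R] by (intro eq_matI) (simp_all del: index_mult_mat)
    then have "?y (a \<cdot>\<^sub>v \<chi> + b \<cdot>\<^sub>v \<chi>') x = a \<cdot>\<^sub>v ?y \<chi> x + b \<cdot>\<^sub>v ?y \<chi>' x"
      using add_mult_distrib_mat_vec[OF smult_carrier_mat[OF Rt] smult_carrier_mat[OF Rt] x]
        smult_mat_mult_vec[OF Rt x] by simp
    then have "?q (?y (a \<cdot>\<^sub>v \<chi> + b \<cdot>\<^sub>v \<chi>') x) \<le> a * ?q (?y \<chi> x) + b * ?q (?y \<chi>' x)"
      using psd_quadratic_form_convex[OF \<Sigma> yc yc ab] by simp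
    also have "\<dots> \<le> a * ((T *\<^sub>v x) \<bullet> x) + b * ((T *\<^sub>v x) \<bullet> x)"
      using q ab by (intro add_mono mult_left_mono)
    also have "\<dots> = (T *\<^sub>v x) \<bullet> x"
      using arg_cong[OF ab(3), of "\<lambda>t. t * ((T *\<^sub>v x) \<bullet> x)"] by (simp add: algebra_simps)
    finally show ?case .
  qed
qed

theorem proposition3:
  fixes M :: "'w measure"
    and S :: lin_sys
    and \<Sigma>0 :: "real mat"
    and s0 :: "'w \<Rightarrow> real vec"
    and e :: "nat \<Rightarrow> 'w \<Rightarrow> real vec"
    and s :: nat
    and Q :: "nat \<Rightarrow> real mat"
    and nk :: nat
    and Qj \<Sigma>j :: "real mat"
  assumes "prob_space M"
    and "wf_sys S"
    and "\<Sigma>0 \<in> pd_mats (nx S)"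
    and "noise_model M S \<Sigma>0 s0 e"
    and "\<forall>i \<in> {1..s}. Q i \<in> psd_mats (n_zeta S)"
    and "finsum (module_mat TYPE(real) (n_zeta S) (n_zeta S)) Q {1..s} \<in> pd_mats (n_zeta S)"
    and "0 < nk"
    and "Qj \<in> carrier_mat nk (n_w S)"
    and "\<Sigma>j \<in> pd_mats nk"
  shows "(\<forall>\<chi> \<in> carrier_vec (n_chi S).
            (\<forall>\<zeta> \<in> uncertainty_set S s Q.
               loewner_le nk (Qj * Sigma_w M S s0 e \<chi> \<zeta> * transpose_mat Qj) \<Sigma>j)
            \<longleftrightarrow>
            loewner_le nk
              (Qj * calBs S \<chi> * Sigma_eps S \<Sigma>0 * transpose_mat (calBs S \<chi>) * transpose_mat Qj) \<Sigma>j)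
         \<and> convex_vecs {\<chi> \<in> carrier_vec (n_chi S).
             loewner_le nk
               (Qj * calBs S \<chi> * Sigma_eps S \<Sigma>0 * transpose_mat (calBs S \<chi>) * transpose_mat Qj) \<Sigma>j}"
proof -
  let ?\<Sigma> = "Sigma_eps S \<Sigma>0" and ?m = "nx S + horizon S * ne S"
  have \<Sigma>0: "\<Sigma>0 \<in> psd_mats (nx S)" and \<Sigma>j: "\<Sigma>j \<in> psd_mats nk"
    using assms(3,9) pd_mats_subset_psd_mats by auto
  note \<Sigma> = Sigma_eps_psd[OF \<Sigma>0]
  then have \<Sigma>c: "?\<Sigma> \<in> carrier_mat ?m ?m" by (simp add: psd_mats_def)
  note B = calBs_carrier
  have Bt: "transpose_mat (calBs S \<chi>) \<in> carrier_mat ?m (n_w S)" for \<chi> using B by simp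
  have Qt: "transpose_mat Qj \<in> carrier_mat (n_w S) nk" using assms(8) by simp
  have QBS: "Qj * calBs S \<chi> * ?\<Sigma> \<in> carrier_mat nk ?m" for \<chi>
    by (rule mult_carrier_mat[OF mult_carrier_mat[OF assms(8) B] \<Sigma>c])
  \<comment> \<open>The right side does not mention \<open>\<zeta>\<close>: the robust constraint
    asks for the same inequality at every \<open>\<zeta>\<close>.\<close>
  have cov: "Qj * Sigma_w M S s0 e \<chi> \<zeta> * transpose_mat Qj
      = Qj * calBs S \<chi> * ?\<Sigma> * transpose_mat (calBs S \<chi>) * transpose_mat Qj" for \<chi> \<zeta>
    unfolding Sigma_w_eq[OF assms(1,2) \<Sigma>0 assms(4)]
      assoc_mult_mat[OF assms(8) B \<Sigma>c]
      assoc_mult_mat[OF assms(8) mult_carrier_mat[OF B \<Sigma>c] Bt] ..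
  \<comment> \<open>Regrouped as a congruence with factor \<open>Qj * calBs S \<chi>\<close>, the
    form for which convexity is established.\<close>
  have fact: "Qj * calBs S \<chi> * ?\<Sigma> * transpose_mat (calBs S \<chi>) * transpose_mat Qj
      = (Qj * calBs S \<chi>) * ?\<Sigma> * transpose_mat (Qj * calBs S \<chi>)" for \<chi>
    unfolding transpose_mult[OF assms(8) B] by (rule assoc_mult_mat[OF QBS Bt Qt])
  have "uncertainty_set S s Q \<noteq> {}"
    using zero_in_uncertainty_set[of s Q S] assms(5) by auto
  then show ?thesis
    unfolding cov using convex_covariance_constraint[OF \<Sigma> assms(8) \<Sigma>j]
    by (auto simp: fact)
qed

end
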